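(* Let $\{Z_t\}_{t\ge0}$ be a $(q,r)$-extendable branching process with offspring generating function $f$, where $r>1$ and $f'(r)<\infty$. Let $T$ be the absorption time, $\alpha=1-f'(q)$, $\beta=f'(r)-1$, $\gamma=\alpha/\beta$, and for $s\in[0,r)$ put $$K(s)=(s-q)(r-q)^\gamma(r-s)^{-\gamma}\exp\Big\{\int_s^q\psi_{q,r}(x)\,dx\Big\},\qquad \psi_{q,r}(x)=\frac{f^{(4)}(q,q,r,x)-\gamma f^{(4)}(q,r,r,x)}{f^{(3)}(q,r,x)}.$$ Then, as $t\to\infty$, $$\mathrm{P}(T>t)=(K(1)-K(0))e^{-\alpha t}+\frac{f''(q)}{2\alpha}\big(K^2(1)-K^2(0)\big)e^{-2\alpha t}+o(e^{-2\alpha t}),$$ and moreover $$\mathrm{P}(Z_t=k\,|\,T>t)\to\pi_k,\quad k\ge1,\qquad\sum_{k=1}^\infty\pi_ks^k=\frac{K(s)-K(0)}{K(1)-K(0)}.$$ If $f$ is modified linear-fractional, then $K(s)=(s-q)(r-q)^\gamma(r-s)^{-\gamma}$, and $\pi_k\sim c\,k^{1-\gamma}r^{-k}$ as $k\to\infty$ for some positive constant $c$.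
   Context: Branching process: $f(s)=\sum_{k\ge0}p_ks^k$ with $p_k\ge0$, $f(1)\le1$, $p_1\ne1$. $\{Z_t\}_{t\ge0}$ is the continuous-time Markov branching process with $Z_0=1$: particles have independent exponential life lengths with parameter 1; at death a particle is, independently of everything else, replaced by $k$ particles with probability $p_k$, $k\ge0$, while with probability $1-f(1)$ it sends the whole process to an absorbing graveyard state $\Delta$. $T_0$ is the time of absorption at $0$, $T_1$ the time of absorption at $\Delta$ (each $=\infty$ if it does not happen), and $T=\min(T_0,T_1)$. The process is $(q,r)$-extendable, where $0\le q\le1\le r<\infty$, $q<r$, if $f(q)=q$ and $f(r)=r$ (with $f$ the power series). Tail generating functions: for $v(s)=\sum_{k\ge0}v_ks^k$ with all $v_k\ge0$ and $n\ge1$, $$v^{(n)}(s_1,\ldots,s_n)=\sum_{i_1\ge0,\ldots,i_n\ge0}v_{i_1+\cdots+i_n+n-1}\,s_1^{i_1}\cdots s_n^{i_n}.$$ $f$ is modified linear-fractional if $f(s)=p_0+p_1s+(1-p_0-p_1-p_\Delta)s^2(1-p)(1-ps)^{-1}$ for $s\in[0,p^{-1})$, with $p_0,p_1,p_\Delta,p\in[0,1)$ and $p_0+p_1+p_\Delta<1$.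
   Formalization: Two printed formulas are false and are corrected: the second-order term of P(T>t) has a minus sign, −f''(q)/(2α)·(K²(1)−K²(0))e^{−2αt}, and in the modified linear-fractional case π_k ~ c k^{γ−1} r^{−k} instead of c k^{1−γ} r^{−k}. *)

theory Defs
  imports "HOL-Probability.Probability" "HOL-Library.Landau_Symbols"
begin

definition gf :: "(nat \<Rightarrow> real) \<Rightarrow> real \<Rightarrow> real" where
  "gf v s = (\<Sum>k. v k * s ^ k)"

text \<open>
  Derivatives of a generating function are the termwise differentiated series
  \<open>gf (diffs v)\<close>. This is the ordinary derivative inside the disc of convergence, and the
  left derivative at a point that may lie on its boundary.
\<close>

lemma gf_has_derivative:
  assumes "summable (\<lambda>k. v k * r ^ k)" "\<bar>s\<bar> < r"
  shows "(gf v has_real_derivative gf (diffs v) s) (at s)"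
  unfolding gf_def [abs_def] using termdiffs_strong[of v r s] assms by simp

lemma gf_has_left_derivative:
  assumes nn: "\<And>k. v k \<ge> 0" and r: "r > 0"
    and v: "summable (\<lambda>k. v k * r ^ k)" and d: "summable (\<lambda>k. diffs v k * r ^ k)"
  shows "(gf v has_real_derivative gf (diffs v) r) (at r within {0..r})"
proof -
  define h where "h s k = v k * (\<Sum>i<k. r ^ (k - Suc i) * s ^ i)" for s k
  have d': "summable (\<lambda>k. v k * (real k * r ^ (k - 1)))"
    by (subst summable_Suc_iff [symmetric]) (use d in \<open>simp add: diffs_def mult_ac\<close>)
  have hb: "norm (h s k) \<le> v k * (real k * r ^ (k - 1))" if s: "s \<in> {0..r}" for s k
  proof -
    have "(\<Sum>i<k. r ^ (k - Suc i) * s ^ i) \<le> (\<Sum>i<k. r ^ (k - 1))"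
    proof (rule sum_mono)
      fix i assume "i \<in> {..<k}"
      then have e: "k - 1 = (k - Suc i) + i" by simp
      have "r ^ (k - Suc i) * s ^ i \<le> r ^ (k - Suc i) * r ^ i"
        using s r by (intro mult_left_mono power_mono) auto
      then show "r ^ (k - Suc i) * s ^ i \<le> r ^ (k - 1)"
        unfolding e power_add .
    qed
    then have "v k * (\<Sum>i<k. r ^ (k - Suc i) * s ^ i) \<le> v k * (real k * r ^ (k - 1))"
      using nn by (intro mult_left_mono) auto
    moreover have "h s k \<ge> 0"
      unfolding h_def using nn s r by (intro mult_nonneg_nonneg sum_nonneg) auto
    ultimately show ?thesis by (simp add: h_def)
  qed
  have "uniform_limit {0..r} (\<lambda>n s. \<Sum>k<n. h s k) (\<lambda>s. \<Sum>k. h s k) sequentially"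
    using Weierstrass_m_test[OF hb d'] .
  then have "continuous_on {0..r} (\<lambda>s. \<Sum>k. h s k)"
    by (rule uniform_limit_theorem[rotated])
       (auto simp: h_def intro!: always_eventually continuous_intros)
  then have lim: "((\<lambda>s. \<Sum>k. h s k) \<longlongrightarrow> (\<Sum>k. h r k)) (at r within {0..r})"
    using r by (auto simp: continuous_on_def)
  have hr: "h r k = v k * (real k * r ^ (k - 1))" for k
  proof -
    have "(\<Sum>i<k. r ^ (k - Suc i) * r ^ i) = (\<Sum>i<k. r ^ (k - 1))"
      by (intro sum.cong refl) (simp flip: power_add)
    then show ?thesis by (simp add: h_def)
  qed
  have "(\<Sum>k. h r k) = gf (diffs v) r"
    unfolding hr gf_def using suminf_split_head[OF d'] by (simp add: diffs_def mult_ac)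
  moreover have "(gf v s - gf v r) / (s - r) = (\<Sum>k. h s k)" if s: "s \<in> {0..r}" "s \<noteq> r" for s
  proof -
    have "summable (\<lambda>k. v k * s ^ k)"
      by (rule summable_comparison_test[OF _ v])
         (use s nn r in \<open>auto simp: abs_mult intro!: mult_left_mono power_mono\<close>)
    then have "gf v s - gf v r = (\<Sum>k. v k * s ^ k - v k * r ^ k)"
      unfolding gf_def using v by (rule suminf_diff)
    also have "\<dots> = (\<Sum>k. h s k * (s - r))"
      by (intro suminf_cong)
         (simp add: h_def power_diff_sumr2 algebra_simps flip: right_diff_distrib)
    also have "\<dots> = (\<Sum>k. h s k) * (s - r)"
      using summable_comparison_test[OF _ d', of "h s"] hb s
      by (intro suminf_mult2 [symmetric]) auto
    finally show ?thesis using s by simp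
  qed
  ultimately show ?thesis
    unfolding has_field_derivative_iff
    by (intro Lim_transform_within[OF lim[unfolded \<open>(\<Sum>k. h r k) = gf (diffs v) r\<close>] zero_less_one]) auto
qed

definition extendable :: "(nat \<Rightarrow> real) \<Rightarrow> real \<Rightarrow> real \<Rightarrow> bool" where
  "extendable p q r \<longleftrightarrow> 0 \<le> q \<and> q \<le> 1 \<and> 1 \<le> r \<and> q < r \<and>
     (\<lambda>k. p k * q ^ k) sums q \<and> (\<lambda>k. p k * r ^ k) sums r"

text \<open>
  \<open>tail_gf v [s\<^sub>1, \<dots>, s\<^sub>n]\<close> for \<open>n \<ge> 1\<close>; the multi-indices are the lists of length \<open>n\<close>.
\<close>

definition tail_gf :: "(nat \<Rightarrow> real) \<Rightarrow> real list \<Rightarrow> real" where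
  "tail_gf v ss = (\<Sum>\<^sub>\<infinity>ks | length ks = length ss.
     v (sum_list ks + length ss - 1) * (\<Prod>j<length ss. (ss ! j) ^ (ks ! j)))"

definition modified_linear_fractional :: "(nat \<Rightarrow> real) \<Rightarrow> bool" where
  "modified_linear_fractional v \<longleftrightarrow>
     (\<exists>p0 p1 pD p. {p0, p1, pD, p} \<subseteq> {0..<1} \<and> p0 + p1 + pD < 1 \<and>
       (\<forall>s. 0 \<le> s \<and> p * s < 1 \<longrightarrow>
         (\<lambda>k. v k * s ^ k) sums
           (p0 + p1 * s + (1 - p0 - p1 - pD) * s\<^sup>2 * (1 - p) / (1 - p * s))))"

text \<open>
  Particles are labelled by \<open>nat list\<close>: the root is \<open>[]\<close>, and the children of \<open>u\<close> are
  \<open>i # u\<close>. The particle \<open>u\<close> has life length \<open>L u\<close>; at its death it is replaced by \<open>k\<close>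
  particles if \<open>X u = Some k\<close>, while \<open>X u = None\<close> sends the whole process to the graveyard.
\<close>

locale branching_process = prob_space M
  for M :: "'w measure" +
  fixes p :: "nat \<Rightarrow> real"
    and L :: "nat list \<Rightarrow> 'w \<Rightarrow> real"
    and X :: "nat list \<Rightarrow> 'w \<Rightarrow> nat option"
  assumes p_nonneg: "\<And>k. p k \<ge> 0"
    and p_summable: "summable p"
    and p_sum_le_1: "gf p 1 \<le> 1"
    and p_1: "p 1 \<noteq> 1"
    and L_distributed: "\<And>u. distributed M lborel (L u) (exponential_density 1)"
    and X_measurable: "\<And>u. random_variable (count_space UNIV) (X u)"
    and X_Some: "\<And>u k. \<P>(\<omega> in M. X u \<omega> = Some k) = p k"
    and X_None: "\<And>u. \<P>(\<omega> in M. X u \<omega> = None) = 1 - gf p 1"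
    and indep: "indep_sets
      (case_sum (\<lambda>u. {L u -` A \<inter> space M |A. A \<in> sets borel})
                (\<lambda>u. {X u -` B \<inter> space M |B. B \<in> sets (count_space UNIV)}))
      (UNIV :: (nat list + nat list) set)"

context
  fixes L :: "nat list \<Rightarrow> 'w \<Rightarrow> real" and X :: "nat list \<Rightarrow> 'w \<Rightarrow> nat option"
begin

fun birth_time :: "nat list \<Rightarrow> 'w \<Rightarrow> real" where
  "birth_time [] \<omega> = 0"
| "birth_time (i # u) \<omega> = birth_time u \<omega> + L u \<omega>"

fun realized :: "nat list \<Rightarrow> 'w \<Rightarrow> bool" where
  "realized [] \<omega> \<longleftrightarrow> True"
| "realized (i # u) \<omega> \<longleftrightarrow> realized u \<omega> \<and> (\<exists>k. X u \<omega> = Some k \<and> i < k)"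

definition death_time :: "nat list \<Rightarrow> 'w \<Rightarrow> real" where
  "death_time u \<omega> = birth_time u \<omega> + L u \<omega>"

definition alive :: "real \<Rightarrow> 'w \<Rightarrow> nat list set" where
  "alive t \<omega> = {u. realized u \<omega> \<and> birth_time u \<omega> \<le> t \<and> t < death_time u \<omega>}"

text \<open>
  The state \<open>None\<close> is the graveyard. The count is extended-valued because explosion is not
  excluded by the definition.
\<close>

definition Z :: "real \<Rightarrow> 'w \<Rightarrow> enat option" where
  "Z t \<omega> =
     (if \<exists>u. realized u \<omega> \<and> X u \<omega> = None \<and> death_time u \<omega> \<le> t then None
      else if finite (alive t \<omega>) then Some (enat (card (alive t \<omega>)))
      else Some \<infinity>)"

definition T0 :: "'w \<Rightarrow> ereal" where
  "T0 \<omega> = Inf (ereal ` {t. 0 \<le> t \<and> Z t \<omega> = Some 0})"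

definition T1 :: "'w \<Rightarrow> ereal" where
  "T1 \<omega> = Inf (ereal ` {t. 0 \<le> t \<and> Z t \<omega> = None})"

definition absorption_time :: "'w \<Rightarrow> ereal" where
  "absorption_time \<omega> = min (T0 \<omega>) (T1 \<omega>)"

end

end

theory Submission
  imports Defs "HOL-Complex_Analysis.Complex_Analysis" "HOL-Real_Asymp.Real_Asymp"
begin

text \<open>
  Conditioning on the first death gives a renewal equation for
  \<open>F\<^sub>t(s) = E s ^ Z\<^sub>t\<close>, \<open>0 \<le> s \<le> 1\<close>, which turns into the equation
  \<open>F' = f(F) - F\<close>. On the other hand \<open>K' / K = - \<alpha> / (f - id)\<close>, so that
  \<open>K(F\<^sub>t(s)) = exp (- \<alpha> t) K(s)\<close>. Since \<open>K\<close> vanishes to first order at \<open>q\<close>, expanding it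
  there to second order yields the survival probability
  \<open>F\<^sub>t(1) - F\<^sub>t(0)\<close>, and to first order the limit of \<open>exp (\<alpha> t) (F\<^sub>t(s) - F\<^sub>t(0))\<close>, hence of
  its coefficients. That the power series of the limit represents \<open>K\<close> on all of \<open>[0, r)\<close>
  holds because \<open>f - id\<close> has no zero besides \<open>q\<close> in the complex disc of radius \<open>r\<close>, where \<open>K\<close> is
  therefore holomorphic.
\<close>

section \<open>Power series with nonnegative coefficients\<close>

text \<open>The point r may lie on the circle of convergence, where only f and f' are known to be
  finite. Near r the argument therefore uses iterated divided differences, which have nonnegative
  coefficients, in place of higher derivatives. Dividing out both fixed points gives f(x) - x = (x -
  q)(x - r) C(x) with C > 0 and (r - q) C(q) = \<alpha>, (r - q) C(r) = \<beta>. Hence - \<alpha> /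
  (f - id) has the singular parts 1 / (x - q) and \<gamma> / (r - x), with remainder - \<psi>: this
  is the origin of both the exponent \<gamma> and \<psi>. As K(q + y) = y + \<eta>(q) y^2 + ... with
  \<eta>(q) = f''(q) / (2 \<alpha>), inverting K puts a minus sign before the term in exp (- 2
  \<alpha> t); and the coefficients of (r - s) powr (- \<gamma>) are of order k powr (\<gamma> - 1)
  r powr (- k). The formal conclusion has this sign and this exponent, whereas the English statement
  prints a plus sign and 1 - \<gamma>.\<close>

lemma summable_gf_mono:
  fixes v :: "nat \<Rightarrow> real"
  assumes "\<And>k. v k \<ge> 0" "summable (\<lambda>k. v k * r ^ k)" "\<bar>x\<bar> \<le> r"
  shows "summable (\<lambda>k. v k * x ^ k)"
proof (rule summable_comparison_test[OF _ assms(2)], intro exI allI impI)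
  fix n
  show "norm (v n * x ^ n) \<le> v n * r ^ n"
    using assms by (auto simp: abs_mult power_abs intro!: mult_left_mono power_mono)
qed

lemma gf_nonneg:
  assumes "\<And>k. v k \<ge> 0" "summable (\<lambda>k. v k * x ^ k)" "x \<ge> 0"
  shows "gf v x \<ge> 0"
  unfolding gf_def by (rule suminf_nonneg) (use assms in auto)

lemma gf_mono:
  assumes "\<And>k. v k \<ge> 0" "summable (\<lambda>k. v k * y ^ k)" "0 \<le> x" "x \<le> y"
  shows "gf v x \<le> gf v y"
  unfolding gf_def
  by (intro suminf_le summable_gf_mono[OF assms(1,2)] assms(2) mult_left_mono power_mono)
     (use assms in auto)

lemma gf_ge_head:
  assumes "\<And>k. v k \<ge> 0" "summable (\<lambda>k. v k * x ^ k)" "0 \<le> x"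
  shows "v 0 \<le> gf v x"
  using sum_le_suminf[OF assms(2), of "{0}"] assms unfolding gf_def by auto

lemma gf_cmult:
  assumes "summable (\<lambda>k. v k * x ^ k)"
  shows "gf (\<lambda>k. a * v k) x = a * gf v x"
  using suminf_mult[OF assms, of a] by (simp add: gf_def mult.assoc)

lemma gf_continuous_on:
  fixes v :: "nat \<Rightarrow> real"
  assumes nn: "\<And>k. v k \<ge> 0" and v: "summable (\<lambda>k. v k * r ^ k)"
  shows "continuous_on {0..r} (gf v)"
proof -
  have "uniform_limit {0..r} (\<lambda>n s. \<Sum>k<n. v k * s ^ k) (\<lambda>s. \<Sum>k. v k * s ^ k) sequentially"
    by (rule Weierstrass_m_test[OF _ v])
       (use nn in \<open>auto simp: abs_mult intro!: mult_left_mono power_mono\<close>)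
  then have "continuous_on {0..r} (\<lambda>s. \<Sum>k. v k * s ^ k)"
    by (rule uniform_limit_theorem[rotated]) (auto intro!: always_eventually continuous_intros)
  then show ?thesis by (simp add: gf_def [abs_def])
qed

text \<open>With nonnegative coefficients, boundedness near r suffices for convergence at r: each
  partial sum is a polynomial, so the bound \<open>B\<close> passes to the limit. This is how
  finiteness of a derivative at r becomes convergence of a divided difference there.\<close>

lemma summable_gf_boundary:
  fixes v :: "nat \<Rightarrow> real"
  assumes nn: "\<And>k. v k \<ge> 0" and r: "0 \<le> a" "a < r"
    and v: "\<And>x. a < x \<Longrightarrow> x < r \<Longrightarrow> summable (\<lambda>k. v k * x ^ k)"
    and b: "\<And>x. a < x \<Longrightarrow> x < r \<Longrightarrow> gf v x \<le> B"
  shows "summable (\<lambda>k. v k * r ^ k)"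
proof (rule bounded_imp_summable)
  show "0 \<le> v n * r ^ n" for n using nn r by auto
  fix n
  have "((\<lambda>x. \<Sum>k\<le>n. v k * x ^ k) \<longlongrightarrow> (\<Sum>k\<le>n. v k * r ^ k)) (at_left r)"
    by (auto intro!: tendsto_eq_intros)
  moreover have "eventually (\<lambda>x. (\<Sum>k\<le>n. v k * x ^ k) \<le> B) (at_left r)"
    using eventually_at_left_real[OF r(2)]
  proof eventually_elim
    case (elim x)
    then have "(\<Sum>k\<le>n. v k * x ^ k) \<le> gf v x"
      unfolding gf_def by (intro sum_le_suminf v) (use nn r elim in auto)
    with b[of x] elim show ?case by auto
  qed
  ultimately show "(\<Sum>k\<le>n. v k * r ^ k) \<le> B"
    by (intro tendsto_upperbound[where F = "at_left r"]) auto
qed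

text \<open>
  \<open>divdiff y v\<close> are the coefficients of the divided difference \<open>(v(x) - v(y)) / (x - y)\<close>;
  iterating it produces the tail generating functions.
\<close>

definition divdiff :: "real \<Rightarrow> (nat \<Rightarrow> real) \<Rightarrow> nat \<Rightarrow> real" where
  "divdiff y v m = gf (\<lambda>j. v (Suc (j + m))) y"

lemma summable_shift_gf:
  fixes v :: "nat \<Rightarrow> real"
  assumes "summable (\<lambda>k. v k * y ^ k)"
  shows "summable (\<lambda>j. v (Suc (j + m)) * y ^ j)"
proof (cases "y = 0")
  case True
  then show ?thesis by simp
next
  case False
  have "summable (\<lambda>j. v (j + Suc m) * y ^ (j + Suc m))"
    using assms by (subst summable_iff_shift)
  then have "summable (\<lambda>j. v (j + Suc m) * y ^ (j + Suc m) / y ^ Suc m)"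
    by (rule summable_divide)
  then show ?thesis using False by (simp add: power_add)
qed

lemma divdiff_Suc:
  assumes "summable (\<lambda>k. v k * y ^ k)"
  shows "divdiff y v m = v (Suc m) + y * divdiff y v (Suc m)"
  using suminf_split_head[OF summable_shift_gf[OF assms, of m]]
    suminf_mult[OF summable_shift_gf[OF assms, of "Suc m"], of y]
  by (simp add: divdiff_def gf_def algebra_simps)

lemma gf_eq_divdiff:
  assumes "summable (\<lambda>k. v k * y ^ k)"
  shows "gf v y = v 0 + y * divdiff y v 0"
  using suminf_split_head[OF assms]
    suminf_mult[OF summable_shift_gf[OF assms, of 0], of y]
  by (simp add: divdiff_def gf_def algebra_simps)

lemma divdiff_nonneg:
  assumes "\<And>k. v k \<ge> 0" "summable (\<lambda>k. v k * y ^ k)" "y \<ge> 0"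
  shows "divdiff y v m \<ge> 0"
  unfolding divdiff_def by (rule gf_nonneg) (use assms summable_shift_gf in auto)

section \<open>Complex values of the series and of divided differences\<close>

definition cgf :: "(nat \<Rightarrow> real) \<Rightarrow> complex \<Rightarrow> complex" where
  "cgf v z = (\<Sum>k. of_real (v k) * z ^ k)"

lemma cgf_of_real:
  assumes "summable (\<lambda>k. v k * x ^ k)"
  shows "cgf v (of_real x) = of_real (gf v x)"
  using suminf_of_real[OF assms, where 'a = complex] by (simp add: cgf_def gf_def)

lemma summable_cgf:
  fixes v :: "nat \<Rightarrow> real"
  assumes "\<And>k. v k \<ge> 0" "summable (\<lambda>k. v k * x ^ k)" "norm z \<le> x"
  shows "summable (\<lambda>k. of_real (v k) * z ^ k :: complex)"
  by (rule summable_comparison_test[OF _ assms(2)])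
     (use assms in \<open>auto simp: norm_mult norm_power intro!: mult_left_mono power_mono\<close>)

lemma norm_cgf_le:
  assumes "\<And>k. v k \<ge> 0" "summable (\<lambda>k. v k * norm z ^ k)"
  shows "norm (cgf v z) \<le> gf v (norm z)"
proof -
  have e: "norm (of_real (v k) * z ^ k) = v k * norm z ^ k" for k
    using assms(1) by (simp add: norm_mult norm_power)
  show ?thesis
    using summable_norm[of "\<lambda>k. of_real (v k) * z ^ k"] assms(2) by (simp add: cgf_def gf_def e)
qed

lemma cgf_holomorphic:
  assumes "\<And>k. v k \<ge> 0" "\<And>x. 0 \<le> x \<Longrightarrow> x < r \<Longrightarrow> summable (\<lambda>k. v k * x ^ k)"
  shows "cgf v holomorphic_on ball 0 r"
proof (rule power_series_holomorphic)
  fix w :: complex assume "w \<in> ball 0 r"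
  then show "(\<lambda>k. of_real (v k) * (w - 0) ^ k) sums cgf v w"
    unfolding cgf_def using summable_cgf[OF assms(1) assms(2)[of "norm w"]]
    by (auto intro!: summable_sums)
qed

text \<open>The recursion \<open>divdiff_Suc\<close> makes the product telescope. The complex form
  serves the exclusion of complex zeros and, restricted to real points, yields
  \<open>gf_divdiff\<close>.\<close>

lemma cgf_divdiff:
  assumes "summable (\<lambda>k. v k * y ^ k)" "summable (\<lambda>k. of_real (v k) * z ^ k)"
    and "summable (\<lambda>k. of_real (divdiff y v k) * z ^ k)"
  shows "(z - of_real y) * cgf (divdiff y v) z = cgf v z - of_real (gf v y)"
proof -
  let ?w = "divdiff y v" and ?S = "\<lambda>k. of_real (divdiff y v (Suc k)) * z ^ Suc k"
  have S: "summable ?S"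
    using assms(3) by (subst summable_Suc_iff)
  have V: "summable (\<lambda>k. of_real (v (Suc k)) * z ^ Suc k)"
    using assms(2) by (subst summable_Suc_iff)
  have "z * cgf ?w z = (\<Sum>k. z * (of_real (divdiff y v k) * z ^ k))"
    unfolding cgf_def by (rule suminf_mult [symmetric]) fact
  also have "\<dots> = (\<Sum>k. of_real (v (Suc k)) * z ^ Suc k + of_real y * ?S k)"
    by (subst divdiff_Suc[OF assms(1)]) (simp add: algebra_simps)
  also have "\<dots> = (\<Sum>k. of_real (v (Suc k)) * z ^ Suc k) + of_real y * (\<Sum>k. ?S k)"
    by (subst suminf_add [symmetric]) (use S V in \<open>auto simp: suminf_mult intro!: summable_mult\<close>)
  also have "(\<Sum>k. of_real (v (Suc k)) * z ^ Suc k) = cgf v z - of_real (v 0)"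
    using suminf_split_head[OF assms(2)] by (simp add: cgf_def)
  also have "(\<Sum>k. ?S k) = cgf ?w z - of_real (?w 0)"
    using suminf_split_head[OF assms(3)] by (simp add: cgf_def)
  finally show ?thesis
    using gf_eq_divdiff[OF assms(1)] by (simp add: algebra_simps)
qed

text \<open>The number \<open>divdiff y v k * r ^ Suc k\<close> is at most a tail of
  \<open>gf v r\<close>, so a geometric series dominates for x < r. The node y = r is included, at
  the price of excluding x = r.\<close>

lemma summable_divdiff:
  fixes v :: "nat \<Rightarrow> real"
  assumes nn: "\<And>k. v k \<ge> 0" and v: "summable (\<lambda>k. v k * r ^ k)"
    and y: "0 \<le> y" "y \<le> r" and x: "0 \<le> x" "x < r"
  shows "summable (\<lambda>k. divdiff y v k * x ^ k)"
proof -
  have r: "r > 0" using x by simp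
  have b: "divdiff y v k * r ^ Suc k \<le> gf v r" for k
  proof -
    have "divdiff y v k * r ^ Suc k \<le> divdiff r v k * r ^ Suc k"
      unfolding divdiff_def using nn y r v
      by (intro mult_right_mono gf_mono summable_shift_gf) auto
    also have "\<dots> = (\<Sum>j. v (j + Suc k) * r ^ (j + Suc k))"
      using suminf_mult2[OF summable_shift_gf[OF v, of k], of "r ^ Suc k"]
      by (simp add: divdiff_def gf_def mult_ac power_add)
    also have "\<dots> \<le> gf v r"
      unfolding gf_def using suminf_split_initial_segment[OF v, of "Suc k"] nn r
      by (simp add: sum_nonneg del: sum.lessThan_Suc)
    finally show ?thesis .
  qed
  show ?thesis
  proof (rule summable_comparison_test)
    show "summable (\<lambda>k. gf v r / r * (x / r) ^ k)"
      using x by (intro summable_mult summable_geometric) auto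
    have "norm (divdiff y v k * x ^ k) \<le> gf v r / r * (x / r) ^ k" for k
    proof -
      have "divdiff y v k * x ^ k \<le> gf v r / r ^ Suc k * x ^ k"
        using b[of k] r x by (intro mult_right_mono) (auto simp: field_simps)
      moreover have "divdiff y v k \<ge> 0"
        using y by (intro divdiff_nonneg nn summable_gf_mono[OF nn v]) auto
      ultimately show ?thesis using x by (simp add: power_divide)
    qed
    then show "\<exists>N. \<forall>n\<ge>N. norm (divdiff y v n * x ^ n) \<le> gf v r / r * (x / r) ^ n" by blast
  qed
qed

lemma gf_divdiff:
  assumes nn: "\<And>k. v k \<ge> 0" and v: "summable (\<lambda>k. v k * r ^ k)"
    and y: "0 \<le> y" "y \<le> r" and x: "0 \<le> x" "x \<le> r"
    and w: "summable (\<lambda>k. divdiff y v k * x ^ k)"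
  shows "(x - y) * gf (divdiff y v) x = gf v x - gf v y"
proof -
  have vy: "summable (\<lambda>k. v k * y ^ k)" and vx: "summable (\<lambda>k. v k * x ^ k)"
    using y x by (auto intro!: summable_gf_mono[OF nn v])
  have "(of_real x - of_real y) * cgf (divdiff y v) (of_real x) = cgf v (of_real x) - of_real (gf v y)"
    using x y nn vx w divdiff_nonneg[OF nn vy]
    by (intro cgf_divdiff[OF vy]) (auto intro!: summable_cgf[of _ x])
  then have "complex_of_real ((x - y) * gf (divdiff y v) x) = of_real (gf v x - gf v y)"
    by (simp add: cgf_of_real vx w)
  then show ?thesis by (simp only: of_real_eq_iff)
qed

text \<open>For a node y < r the quotient (v(x) - v(y)) / (x - y) stays bounded as x approaches r.
  Starting at the midpoint of y and r keeps the denominator above (r - y) / 2.\<close>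

lemma summable_divdiff_boundary:
  fixes v :: "nat \<Rightarrow> real"
  assumes nn: "\<And>k. v k \<ge> 0" and v: "summable (\<lambda>k. v k * r ^ k)"
    and y: "0 \<le> y" "y < r"
  shows "summable (\<lambda>k. divdiff y v k * r ^ k)"
proof (rule summable_gf_boundary[where a = "(y + r) / 2" and B = "gf v r / ((r - y) / 2)"])
  have vy: "summable (\<lambda>k. v k * y ^ k)"
    using y by (auto intro!: summable_gf_mono[OF nn v])
  show "0 \<le> divdiff y v k" for k
    by (rule divdiff_nonneg) (use nn vy y in auto)
  fix x assume x: "(y + r) / 2 < x" "x < r"
  show s: "summable (\<lambda>k. divdiff y v k * x ^ k)"
    by (rule summable_divdiff[OF nn v]) (use x y in auto)
  have "gf (divdiff y v) x = (gf v x - gf v y) / (x - y)"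
    using gf_divdiff[OF nn v, of y x] x y s by (auto simp: field_simps)
  also have "\<dots> \<le> gf v r / (x - y)"
    using x y gf_mono[OF nn v, of x] gf_nonneg[OF nn vy]
    by (intro divide_right_mono) auto
  also have "\<dots> \<le> gf v r / ((r - y) / 2)"
    using x y gf_nonneg[OF nn v] by (intro divide_left_mono) auto
  finally show "gf (divdiff y v) x \<le> gf v r / ((r - y) / 2)" .
qed (use y in auto)

text \<open>Zeros of a nonzero power series are isolated, so agreement to the right of 0
  suffices.\<close>

lemma power_series_unique:
  fixes a b :: "nat \<Rightarrow> real"
  assumes r: "0 < r" and a: "\<And>x. 0 < x \<Longrightarrow> x < r \<Longrightarrow> (\<lambda>k. a k * x ^ k) sums f x"
    and b: "\<And>x. 0 < x \<Longrightarrow> x < r \<Longrightarrow> (\<lambda>k. b k * x ^ k) sums f x"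
  shows "a = b"
proof (rule ccontr)
  assume "a \<noteq> b"
  then obtain m where m: "a m - b m \<noteq> 0" by auto
  \<comment> \<open>The shift by one makes \<open>g\<close> vanish at 0 and puts the nonzero
    coefficient at a positive index, as \<open>powser_0_nonzero\<close> requires.\<close>
  define e where "e n = (case n of 0 \<Rightarrow> 0 | Suc k \<Rightarrow> a k - b k)" for n
  define g where "g x = x * (\<Sum>k. (a k - b k) * x ^ k)" for x
  have s: "(\<lambda>k. (a k - b k) * x ^ k) sums 0" if "0 < x" "x < r" for x
    using sums_diff[OF a[OF that] b[OF that]] by (simp add: left_diff_distrib)
  have "(\<lambda>n. e n * (x - 0) ^ n) sums g x" if "norm (x - 0) < r" for x
  proof -
    define y where "y = (\<bar>x\<bar> + r) / 2"
    have "\<bar>x\<bar> < y" "0 < y" "y < r" using that r by (auto simp: y_def)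
    then have "summable (\<lambda>k. (a k - b k) * x ^ k)"
      using powser_inside[OF sums_summable[OF s[of y]], of x] by simp
    from sums_mult[OF summable_sums[OF this], of x]
    have "(\<lambda>k. e (Suc k) * x ^ Suc k) sums g x"
      by (simp add: e_def g_def mult_ac)
    then show ?thesis by (subst (asm) sums_Suc_iff) (simp add: e_def)
  qed
  moreover have "g 0 = 0" "e (Suc m) \<noteq> 0" using m by (auto simp: g_def e_def)
  ultimately obtain d where d: "0 < d" "\<And>z. z \<in> cball 0 d - {0} \<Longrightarrow> g z \<noteq> 0"
    using powser_0_nonzero[OF r, of 0 e g "Suc m"] by blast
  define z where "z = min d (r / 2)"
  have "0 < z" "z < r" "z \<le> d" using d(1) r by (auto simp: z_def)
  then have "g z = 0" using s[of z] by (simp add: g_def sums_iff)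
  moreover have "g z \<noteq> 0" using d(2)[of z] \<open>0 < z\<close> \<open>z \<le> d\<close> by auto
  ultimately show False by simp
qed

text \<open>Induction on the coefficient index: with the earlier coefficients removed, the series
  divided by s ^ k lies between \<open>a t k\<close> and \<open>a t k + B * s / (1 - s)\<close>. Its
  limit in t is known for fixed s, and the error vanishes as s tends to 0.\<close>

lemma power_series_coeff_tendsto:
  fixes a :: "'i \<Rightarrow> nat \<Rightarrow> real" and c :: "nat \<Rightarrow> real"
  assumes nn: "\<And>t k. a t k \<ge> 0"
    and bd: "eventually (\<lambda>t. \<forall>k. a t k \<le> B) F"
    and a: "\<And>t s. 0 < s \<Longrightarrow> s < 1 \<Longrightarrow> (\<lambda>k. a t k * s ^ k) sums A t s"
    and c: "\<And>s. 0 < s \<Longrightarrow> s < 1 \<Longrightarrow> (\<lambda>k. c k * s ^ k) sums C s"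
    and lim: "\<And>s. 0 < s \<Longrightarrow> s < 1 \<Longrightarrow> ((\<lambda>t. A t s) \<longlongrightarrow> C s) F"
  shows "((\<lambda>t. a t k) \<longlongrightarrow> c k) F"
proof (induction k rule: less_induct)
  case (less k)
  define R where "R t s = (A t s - (\<Sum>j<k. a t j * s ^ j)) / s ^ k" for t s
  define D where "D s = (C s - (\<Sum>j<k. c j * s ^ j)) / s ^ k" for s
  have shift: "(\<lambda>j. v (j + k) * s ^ j) sums ((V - (\<Sum>j<k. v j * s ^ j)) / s ^ k)"
    if "(\<lambda>j. v j * s ^ j) sums V" "0 < s" for v :: "nat \<Rightarrow> real" and s V
  proof -
    have "(\<lambda>j. v (j + k) * s ^ (j + k)) sums (V - (\<Sum>j<k. v j * s ^ j))"
      using that(1) by (subst sums_iff_shift) simp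
    from sums_divide[OF this, of "s ^ k"] show ?thesis
      using that(2) by (simp add: power_add)
  qed
  have Rlim: "((\<lambda>t. R t s) \<longlongrightarrow> D s) F" if "0 < s" "s < 1" for s
    unfolding R_def D_def
    by (intro tendsto_intros lim that less) (use that in auto)
  have "(D \<longlongrightarrow> c (0 + k)) (at_right 0)"
  proof -
    have "((\<lambda>s. \<Sum>j. c (j + k) * s ^ j) \<longlongrightarrow> c (0 + k)) (at 0)"
    proof (rule powser_limit_0[of "1/2"])
      fix x :: real assume "norm x < 1 / 2"
      then show "(\<lambda>j. c (j + k) * x ^ j) sums (\<Sum>j. c (j + k) * x ^ j)"
        using powser_inside[OF sums_summable[OF shift[OF c, of "1/2"]], of x] by (simp add: summable_sums)
    qed simp
    then have "((\<lambda>s. \<Sum>j. c (j + k) * s ^ j) \<longlongrightarrow> c (0 + k)) (at_right 0)"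
      by (rule tendsto_within_subset) auto
    moreover have "(\<Sum>j. c (j + k) * s ^ j) = D s" if "s \<in> {0<..<1}" for s
      using sums_unique[OF shift[OF c, of s]] that by (simp add: D_def)
    then have "eventually (\<lambda>s. (\<Sum>j. c (j + k) * s ^ j) = D s) (at_right 0)"
      by (rule eventually_mono[OF eventually_at_right_real[OF zero_less_one]])
    ultimately show ?thesis
      by (rule Lim_transform_eventually)
  qed
  then have Dlim: "(D \<longlongrightarrow> c k) (at_right 0)" by simp
  have Blim: "((\<lambda>s. B * s / (1 - s)) \<longlongrightarrow> 0) (at_right 0)"
    by (auto intro!: tendsto_eq_intros)
  have B: "a t k \<le> R t s" "R t s \<le> a t k + B * s / (1 - s)"
    if s: "0 < s" "s < 1" and t: "\<forall>k. a t k \<le> B" for t s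
  proof -
    have S: "(\<lambda>j. a t (j + k) * s ^ j) sums R t s"
      unfolding R_def by (rule shift[OF a]) (use s in auto)
    show "a t k \<le> R t s"
      using sum_le_suminf[OF sums_summable[OF S], of "{0}"] nn s by (simp add: sums_unique[OF S])
    have S1: "(\<lambda>j. a t (Suc j + k) * s ^ Suc j) sums (R t s - a t (0 + k) * s ^ 0)"
      using S by (subst sums_Suc_iff) simp
    have S2: "(\<lambda>j. B * s * s ^ j) sums (B * s * (1 / (1 - s)))"
      by (intro sums_mult geometric_sums) (use s in auto)
    have "a t (Suc j + k) * s ^ Suc j \<le> B * s * s ^ j" for j
      using t s by (simp add: mult.assoc mult_right_mono del: add_Suc)
    then have "R t s - a t (0 + k) * s ^ 0 \<le> B * s * (1 / (1 - s))"
      using S1 S2 by (rule sums_le)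
    then show "R t s \<le> a t k + B * s / (1 - s)" by simp
  qed
  show ?case
  proof (rule tendstoI)
    fix e :: real assume e: "e > 0"
    \<comment> \<open>The point s is fixed before t, so convergence of \<open>A t s\<close> at this
      single s is enough.\<close>
    have "eventually (\<lambda>s. s \<in> {0<..<1} \<and> dist (D s) (c k) < e / 3 \<and> dist (B * s / (1 - s)) 0 < e / 3) (at_right 0)"
      using eventually_at_right_real[OF zero_less_one] tendstoD[OF Dlim, of "e / 3"] tendstoD[OF Blim, of "e / 3"] e
      by (intro eventually_conj) auto
    from eventually_happens'[OF trivial_limit_at_right_real this]
    obtain s where "s \<in> {0<..<1}" and s': "dist (D s) (c k) < e / 3" "dist (B * s / (1 - s)) 0 < e / 3"
      by blast
    then have s: "0 < s" "s < 1" by auto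
    have "eventually (\<lambda>t. dist (R t s) (D s) < e / 3) F"
      using tendstoD[OF Rlim[OF s], of "e / 3"] e by simp
    then show "eventually (\<lambda>t. dist (a t k) (c k) < e) F"
      using bd
    proof eventually_elim
      case (elim t)
      have tri: "\<bar>x - z\<bar> < e" if "\<bar>R' - y\<bar> < e / 3" "x \<le> R'" "R' \<le> x + w" "\<bar>y - z\<bar> < e / 3"
        "\<bar>w - 0\<bar> < e / 3" for x y z w R' :: real
        using that by linarith
      show ?case
        using tri[OF elim(1)[unfolded dist_real_def] B[OF s elim(2)] s'[unfolded dist_real_def]]
        by (simp only: dist_real_def)
    qed
  qed
qed

section \<open>Tail generating functions\<close>

text \<open>\<open>tail_gf\<close> is an infinite sum with default value 0; the relation records
  convergence as well, which the recursion on the list has to carry along.\<close>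

definition has_tail_gf :: "(nat \<Rightarrow> real) \<Rightarrow> real list \<Rightarrow> real \<Rightarrow> bool" where
  "has_tail_gf v ss S \<longleftrightarrow>
     ((\<lambda>ks. v (sum_list ks + length ss - 1) * (\<Prod>j<length ss. (ss ! j) ^ (ks ! j))) has_sum S)
       {ks. length ks = length ss}"

lemma tail_gf_eqI: "has_tail_gf v ss S \<Longrightarrow> tail_gf v ss = S"
  unfolding has_tail_gf_def tail_gf_def by (rule infsumI)

lemma has_tail_gf_single:
  assumes "\<And>k. v k \<ge> 0" "summable (\<lambda>k. v k * x ^ k)" "x \<ge> 0"
  shows "has_tail_gf v [x] (gf v x)"
proof -
  have "((\<lambda>k. v k * x ^ k) has_sum gf v x) UNIV"
    unfolding gf_def
    by (intro sums_nonneg_imp_has_sum summable_sums) (use assms in auto)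
  moreover have "bij_betw (\<lambda>k. [k]) UNIV {ks :: nat list. length ks = Suc 0}"
    by (auto simp: bij_betw_def inj_on_def length_Suc_conv)
  ultimately show ?thesis
    unfolding has_tail_gf_def
    by (subst has_sum_reindex_bij_betw [symmetric, of "\<lambda>k. [k]" UNIV]) auto
qed

text \<open>Summing over the first index alone produces a divided difference at the first node; the
  double sum may be iterated because all terms are nonnegative. Thus a tail generating function is
  an iterated divided difference.\<close>

lemma has_tail_gf_Cons:
  assumes nn: "\<And>k. v k \<ge> 0" and v: "summable (\<lambda>k. v k * y ^ k)" and y: "y \<ge> 0"
    and ss: "ss \<noteq> []" "\<forall>s\<in>set ss. s \<ge> 0"
    and h: "has_tail_gf (divdiff y v) ss S"
  shows "has_tail_gf v (y # ss) S"
proof -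
  let ?n = "length ss"
  let ?P = "\<lambda>ks. \<Prod>j<?n. (ss ! j) ^ (ks ! j) :: real"
  \<comment> \<open>The index is \<open>sum_list (k # ks) + Suc ?n - 1\<close> for the longer list;
    \<open>ss \<noteq> []\<close> ensures that \<open>?n - 1\<close> is not truncated.\<close>
  let ?f = "\<lambda>(ks, k). v (Suc (k + (sum_list ks + ?n - 1))) * y ^ k * ?P ks"
  let ?A = "{ks :: nat list. length ks = ?n}"
  have P: "?P ks \<ge> 0" for ks using ss by (auto intro!: prod_nonneg)
  have inner: "((\<lambda>k. ?f (ks, k)) has_sum divdiff y v (sum_list ks + ?n - 1) * ?P ks) UNIV" for ks
    unfolding divdiff_def gf_def using nn P y summable_shift_gf[OF v]
    by (auto intro!: has_sum_cmult_left sums_nonneg_imp_has_sum summable_sums)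
  have outer: "((\<lambda>ks. divdiff y v (sum_list ks + ?n - 1) * ?P ks) has_sum S) ?A"
    using h by (simp add: has_tail_gf_def)
  have "?f summable_on Sigma ?A (\<lambda>_. UNIV)"
    by (rule summable_on_SigmaI[OF inner has_sum_imp_summable[OF outer]])
       (use nn P y in \<open>auto intro!: mult_nonneg_nonneg\<close>)
  then have "(?f has_sum S) (Sigma ?A (\<lambda>_. UNIV))"
    by (intro has_sum_SigmaI[OF inner outer])
  moreover have "bij_betw (\<lambda>(ks, k). k # ks) (Sigma ?A (\<lambda>_. UNIV)) {ks :: nat list. length ks = Suc ?n}"
    by (force simp: bij_betw_def inj_on_def length_Suc_conv image_iff)
  ultimately show ?thesis
    unfolding has_tail_gf_def
    apply (simp only: length_Cons)
    apply (subst has_sum_reindex_bij_betw [symmetric, of "\<lambda>(ks, k). k # ks" "Sigma ?A (\<lambda>_. UNIV)"])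
     apply assumption
    apply (rule has_sum_cong[THEN iffD1, rotated], assumption)
    using ss by (auto simp: prod.lessThan_Suc_shift mult_ac Suc_diff_Suc[symmetric] simp del: prod.lessThan_Suc
       intro!: arg_cong[where f = v])
qed

section \<open>The function K\<close>

locale extendable_gf =
  fixes p :: "nat \<Rightarrow> real" and q r :: real
  assumes p_nn: "\<And>k. p k \<ge> 0" and p_1: "p 1 \<noteq> 1"
    and ext: "extendable p q r" and r_gt_1: "r > 1"
    and deriv_r: "summable (\<lambda>k. diffs p k * r ^ k)"
begin

definition "\<alpha> = 1 - gf (diffs p) q"
definition "\<beta> = gf (diffs p) r - 1"
definition "\<gamma> = \<alpha> / \<beta>"

text \<open>
  The function \<open>gf f_qr\<close> is \<open>f\<^bsup>(3)\<^esup>(q, r, \<cdot>)\<close> in the notation of the paper, and similarly for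
  the other index strings.
\<close>

abbreviation "f_q \<equiv> divdiff q p"
abbreviation "f_qq \<equiv> divdiff q f_q"
abbreviation "f_qr \<equiv> divdiff r f_q"
abbreviation "f_qqr \<equiv> divdiff r f_qq"
abbreviation "f_qrr \<equiv> divdiff r f_qr"

section \<open>Factorisation of f - id at its two fixed points\<close>

lemma q_bounds: "0 \<le> q" "q \<le> 1" "q < r" "0 < r"
  using ext r_gt_1 by (auto simp: extendable_def)

lemma p_sum_r: "summable (\<lambda>k. p k * r ^ k)" and gf_q: "gf p q = q" and gf_r: "gf p r = r"
  using ext by (auto simp: extendable_def gf_def dest: sums_summable sums_unique)

lemma summable_p: "0 \<le> x \<Longrightarrow> x \<le> r \<Longrightarrow> summable (\<lambda>k. p k * x ^ k)"
  by (rule summable_gf_mono[OF p_nn p_sum_r]) auto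

lemma f_q_nn: "f_q k \<ge> 0"
  by (rule divdiff_nonneg) (use p_nn summable_p q_bounds in auto)

lemma f_q_sum_r: "summable (\<lambda>k. f_q k * r ^ k)"
  by (rule summable_divdiff_boundary[OF p_nn p_sum_r]) (use q_bounds in auto)

lemma summable_f_q: "0 \<le> x \<Longrightarrow> x \<le> r \<Longrightarrow> summable (\<lambda>k. f_q k * x ^ k)"
  by (rule summable_gf_mono[OF f_q_nn f_q_sum_r]) auto

lemma gf_f_q: "0 \<le> x \<Longrightarrow> x \<le> r \<Longrightarrow> (x - q) * gf f_q x = gf p x - q"
  using gf_divdiff[OF p_nn p_sum_r, of q x] summable_f_q q_bounds by (simp add: gf_q)

lemma gf_f_q_r: "gf f_q r = 1"
  using gf_f_q[of r] q_bounds by (simp add: gf_r)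

lemma f_qr_nn: "f_qr k \<ge> 0"
  by (rule divdiff_nonneg) (use f_q_nn f_q_sum_r q_bounds in auto)

lemma summable_f_qr': "0 \<le> x \<Longrightarrow> x < r \<Longrightarrow> summable (\<lambda>k. f_qr k * x ^ k)"
  by (rule summable_divdiff[OF f_q_nn f_q_sum_r]) (use q_bounds in auto)

lemma gf_f_qr: "0 \<le> x \<Longrightarrow> x < r \<Longrightarrow> (x - r) * gf f_qr x = gf f_q x - 1"
  using gf_divdiff[OF f_q_nn f_q_sum_r, of r x] summable_f_qr' q_bounds by (simp add: gf_f_q_r)

text \<open>Since \<open>gf f_q r = 1\<close>, the second fixed point is divided out of
  \<open>gf f_q - 1\<close> just as the first is divided out of f.\<close>

lemma gf_p_factor: "0 \<le> x \<Longrightarrow> x < r \<Longrightarrow> gf p x - x = (x - q) * (x - r) * gf f_qr x"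
proof -
  assume x: "0 \<le> x" "x < r"
  have "gf p x = q + (x - q) * gf f_q x" "gf f_q x = 1 + (x - r) * gf f_qr x"
    using gf_f_q[of x] gf_f_qr[of x] x by simp_all
  then show ?thesis by (simp add: algebra_simps)
qed

lemma gf_p_has_left_derivative:
  "(gf p has_real_derivative gf (diffs p) r) (at r within {0..r})"
  by (rule gf_has_left_derivative[OF p_nn _ p_sum_r deriv_r]) (use q_bounds in auto)

text \<open>Only the left derivative at r is available: f - id has slope \<beta> there, and the
  other factor x - q tends to r - q.\<close>

lemma f_qr_tendsto: "(gf f_qr \<longlongrightarrow> \<beta> / (r - q)) (at_left r)"
proof -
  have "((\<lambda>x. (gf p x - gf p r) / (x - r)) \<longlongrightarrow> gf (diffs p) r) (at r within {0..r})"
    using gf_p_has_left_derivative by (simp add: has_field_derivative_iff)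
  then have "((\<lambda>x. (gf p x - r) / (x - r)) \<longlongrightarrow> gf (diffs p) r) (at_left r)"
    using q_bounds by (simp add: gf_r at_within_Icc_at_left)
  then have "((\<lambda>x. ((gf p x - r) / (x - r) - 1) / (x - q)) \<longlongrightarrow> (gf (diffs p) r - 1) / (r - q)) (at_left r)"
    by (intro tendsto_divide tendsto_diff tendsto_const tendsto_ident_at) (use q_bounds in auto)
  moreover have "eventually (\<lambda>x. ((gf p x - r) / (x - r) - 1) / (x - q) = gf f_qr x) (at_left r)"
    using eventually_at_left_real[OF q_bounds(3)]
  proof eventually_elim
    case (elim x)
    then have "x - q \<noteq> 0" "x - r \<noteq> 0" by auto
    moreover have "gf p x - x = (x - q) * (x - r) * gf f_qr x"
      using gf_p_factor[of x] elim q_bounds by auto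
    then have "gf p x = x + (x - q) * (x - r) * gf f_qr x" by simp
    ultimately show ?case by (simp add: divide_simps)
  qed
  ultimately show ?thesis
    unfolding \<beta>_def by (rule Lim_transform_eventually)
qed

text \<open>The node r itself is outside \<open>summable_divdiff_boundary\<close>; here finiteness
  of f'(r) supplies the bound near r, through the limit just computed.\<close>

lemma f_qr_sum_r: "summable (\<lambda>k. f_qr k * r ^ k)"
proof -
  have "eventually (\<lambda>x. gf f_qr x < \<beta> / (r - q) + 1) (at_left r)"
    by (rule order_tendstoD[OF f_qr_tendsto]) auto
  then obtain b where b: "b < r" "\<And>x. b < x \<Longrightarrow> x < r \<Longrightarrow> gf f_qr x < \<beta> / (r - q) + 1"
    using q_bounds by (auto simp: eventually_at_left[OF q_bounds(4)])
  show ?thesis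
    by (rule summable_gf_boundary[of _ "max 0 b" _ "\<beta> / (r - q) + 1"])
       (use f_qr_nn summable_f_qr' b q_bounds in \<open>auto intro!: less_imp_le\<close>)
qed

lemma summable_f_qr: "0 \<le> x \<Longrightarrow> x \<le> r \<Longrightarrow> summable (\<lambda>k. f_qr k * x ^ k)"
  by (rule summable_gf_mono[OF f_qr_nn f_qr_sum_r]) auto

lemma gf_f_qr_r: "(r - q) * gf f_qr r = \<beta>"
proof -
  have "(gf f_qr \<longlongrightarrow> gf f_qr r) (at r within {0..r})"
    using gf_continuous_on[OF f_qr_nn f_qr_sum_r] q_bounds by (auto simp: continuous_on_def)
  then have "(gf f_qr \<longlongrightarrow> gf f_qr r) (at_left r)"
    using q_bounds by (simp add: at_within_Icc_at_left)
  then have "gf f_qr r = \<beta> / (r - q)"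
    using f_qr_tendsto by (rule tendsto_unique[rotated]) auto
  then show ?thesis using q_bounds by simp
qed

text \<open>Two fixed points force a genuinely nonlinear \<open>f\<close>, since \<open>p\<^sub>1 \<noteq> 1\<close>.\<close>

lemma f_qr_0_pos: "f_qr 0 > 0"
proof -
  have "\<exists>k. p (Suc (Suc k)) \<noteq> 0"
  proof (rule ccontr)
    assume "\<not> (\<exists>k. p (Suc (Suc k)) \<noteq> 0)"
    then have z: "p (Suc (Suc k)) = 0" for k by auto
    have "(\<Sum>k. p k * x ^ k) = (\<Sum>k<2. p k * x ^ k)" for x
    proof (rule suminf_finite)
      fix n assume "n \<notin> {..<2::nat}"
      then obtain k where "n = Suc (Suc k)"
        by (metis add_2_eq_Suc le_Suc_ex lessThan_iff not_less)
      then show "p n * x ^ n = 0" using z by simp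
    qed auto
    then have lin: "gf p x = p 0 + p 1 * x" for x by (simp add: gf_def numeral_2_eq_2)
    have "r - q = p 1 * (r - q)"
      using gf_q gf_r by (simp add: lin algebra_simps)
    then show False using q_bounds p_1 by simp
  qed
  then obtain k where "p (Suc (Suc k)) > 0" using p_nn[of "Suc (Suc _)"] by (metis less_le)
  moreover have "p (Suc (Suc k)) \<le> f_q (Suc k)"
    unfolding divdiff_def
    using gf_ge_head[OF p_nn summable_shift_gf[OF summable_p[of q], of "Suc k"]] q_bounds
    by (simp del: add_Suc_right)
  ultimately have pos: "f_q (Suc k) > 0" by simp
  have "(\<Sum>j\<in>{k}. f_q (Suc (j + 0)) * r ^ j) \<le> f_qr 0"
    unfolding divdiff_def[of r] gf_def
    by (rule sum_le_suminf) (use summable_shift_gf[OF f_q_sum_r, of 0] f_q_nn q_bounds in auto)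
  moreover have "f_q (Suc k) * r ^ k > 0" using pos q_bounds by simp
  ultimately show ?thesis by simp
qed

lemma gf_f_qr_pos: "0 \<le> x \<Longrightarrow> x \<le> r \<Longrightarrow> gf f_qr x > 0"
  using gf_ge_head[of f_qr x] f_qr_nn summable_f_qr f_qr_0_pos by fastforce

section \<open>Values and derivatives at q\<close>

lemma gf_diffs_has_derivative:
  assumes "0 \<le> x" "x < r"
  shows "(gf p has_real_derivative gf (diffs p) x) (at x)"
  by (rule gf_has_derivative[OF p_sum_r]) (use assms in auto)

lemma f_q_has_derivative:
  assumes "0 \<le> x" "x < r"
  shows "(gf f_q has_real_derivative gf (diffs f_q) x) (at x)"
  by (rule gf_has_derivative[OF f_q_sum_r]) (use assms in auto)

lemma cgf_f_qr:
  assumes "norm z < r"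
  shows "(z - of_real r) * cgf f_qr z = cgf f_q z - 1"
proof -
  have s: "summable (\<lambda>k. of_real (v k) * z ^ k)"
    if "\<And>k. v k \<ge> 0" "summable (\<lambda>k. v k * r ^ k)" for v :: "nat \<Rightarrow> real"
    using summable_cgf[OF that] assms by simp
  show ?thesis
    using cgf_divdiff[OF f_q_sum_r s s] f_q_nn f_q_sum_r f_qr_nn f_qr_sum_r
    by (simp add: gf_f_q_r)
qed

text \<open>A divided difference with coinciding nodes is a derivative.\<close>

lemma gf_f_q_q: "gf f_q q = 1 - \<alpha>"
proof -
  have "((\<lambda>x. q + (x - q) * gf f_q x) has_real_derivative gf f_q q) (at q)"
    by (auto intro!: derivative_eq_intros f_q_has_derivative q_bounds)
  moreover have "eventually (\<lambda>x. q + (x - q) * gf f_q x = gf p x) (nhds q)" if "q > 0"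
    using eventually_nhds_in_open[of "{0<..<r}" q] q_bounds that
    by (auto elim!: eventually_mono simp: gf_f_q)
  ultimately have "gf f_q q = gf (diffs p) q" if "q > 0"
    using that q_bounds gf_diffs_has_derivative[of q]
    by (auto dest: DERIV_unique simp: DERIV_cong_ev)
  \<comment> \<open>If q = 0, the factorisation is available on the right of q only; both sides are
    then the coefficient \<open>p 1\<close>.\<close>
  moreover have "gf f_q q = gf (diffs p) q" if "q = 0"
    using that powser_zero[of "f_q"] powser_zero[of "diffs p"] powser_zero[of "\<lambda>j. p (Suc j)"]
    by (simp add: gf_def divdiff_def diffs_def)
  ultimately show ?thesis using q_bounds by (auto simp: \<alpha>_def less_le)
qed

text \<open>Together with \<open>gf_f_qr_r\<close> this exhibits \<gamma> as the ratio of the values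
  of \<open>gf f_qr\<close> at q and at r, and gives the signs of \<alpha> and \<beta>.\<close>

lemma \<alpha>_eq: "\<alpha> = (r - q) * gf f_qr q"
  using gf_f_qr[of q] q_bounds by (simp add: gf_f_q_q algebra_simps)

lemma \<alpha>_pos: "\<alpha> > 0" and \<beta>_pos: "\<beta> > 0" and \<gamma>_pos: "\<gamma> > 0"
  using gf_f_qr_pos[of q] gf_f_qr_pos[of r] q_bounds
  by (auto simp: \<alpha>_eq \<gamma>_def simp flip: gf_f_qr_r)

lemma f_qq_nn: "f_qq k \<ge> 0"
  by (rule divdiff_nonneg) (use f_q_nn summable_f_q q_bounds in auto)

lemma f_qq_sum_r: "summable (\<lambda>k. f_qq k * r ^ k)"
  by (rule summable_divdiff_boundary[OF f_q_nn f_q_sum_r]) (use q_bounds in auto)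

lemma gf_f_qq_r: "(r - q) * gf f_qq r = \<alpha>"
  using gf_divdiff[OF f_q_nn f_q_sum_r, of q r] f_qq_sum_r q_bounds by (simp add: gf_f_q_r gf_f_q_q)

lemma f_qqr_nn: "f_qqr k \<ge> 0"
  by (rule divdiff_nonneg) (use f_qq_nn f_qq_sum_r q_bounds in auto)

lemma f_qrr_nn: "f_qrr k \<ge> 0"
  by (rule divdiff_nonneg) (use f_qr_nn f_qr_sum_r q_bounds in auto)

lemma summable_f_qqr: "0 \<le> x \<Longrightarrow> x < r \<Longrightarrow> summable (\<lambda>k. f_qqr k * x ^ k)"
  by (rule summable_divdiff[OF f_qq_nn f_qq_sum_r]) (use q_bounds in auto)

lemma summable_f_qrr: "0 \<le> x \<Longrightarrow> x < r \<Longrightarrow> summable (\<lambda>k. f_qrr k * x ^ k)"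
  by (rule summable_divdiff[OF f_qr_nn f_qr_sum_r]) (use q_bounds in auto)

text \<open>The complex extension of \<psi>, through which K is expanded in a power series on all of
  [0, r).\<close>

definition "\<psi>c z = (cgf f_qqr z - of_real \<gamma> * cgf f_qrr z) / cgf f_qr z"
definition "\<psi>r x = (gf f_qqr x - \<gamma> * gf f_qrr x) / gf f_qr x"

lemma \<psi>c_of_real: "0 \<le> x \<Longrightarrow> x < r \<Longrightarrow> \<psi>c (of_real x) = of_real (\<psi>r x)"
  using cgf_of_real[OF summable_f_qqr, of x] cgf_of_real[OF summable_f_qrr, of x]
    cgf_of_real[OF summable_f_qr, of x]
  by (simp add: \<psi>c_def \<psi>r_def)

text \<open>The nodes are consumed from the left, leaving x as the free variable, so the four stages
  build the lists from the right end.\<close>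

lemma \<psi>r_eq:
  assumes "0 \<le> x" "x < r"
  shows "(tail_gf p [q, q, r, x] - \<gamma> * tail_gf p [q, r, r, x]) / tail_gf p [q, r, x] = \<psi>r x"
proof -
  have 1: "has_tail_gf f_qr [x] (gf f_qr x)" "has_tail_gf f_qqr [x] (gf f_qqr x)"
    "has_tail_gf f_qrr [x] (gf f_qrr x)"
    by (rule has_tail_gf_single;
        use f_qr_nn f_qqr_nn f_qrr_nn summable_f_qr summable_f_qqr summable_f_qrr assms in auto)+
  have 2: "has_tail_gf f_q [r, x] (gf f_qr x)" "has_tail_gf f_qr [r, x] (gf f_qrr x)"
    "has_tail_gf f_qq [r, x] (gf f_qqr x)"
    by (rule has_tail_gf_Cons; use 1 f_q_nn f_qr_nn f_qq_nn f_q_sum_r f_qr_sum_r f_qq_sum_r q_bounds assms in auto)+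
  have 3: "has_tail_gf f_q [q, r, x] (gf f_qqr x)" "has_tail_gf f_q [r, r, x] (gf f_qrr x)"
    "has_tail_gf p [q, r, x] (gf f_qr x)"
    by (rule has_tail_gf_Cons; use 2 p_nn f_q_nn summable_p summable_f_q f_q_sum_r q_bounds assms in auto)+
  have 4: "has_tail_gf p [q, q, r, x] (gf f_qqr x)" "has_tail_gf p [q, r, r, x] (gf f_qrr x)"
    by (rule has_tail_gf_Cons; use 3 p_nn summable_p q_bounds assms in auto)+
  show ?thesis
    by (simp add: tail_gf_eqI[OF 4(1)] tail_gf_eqI[OF 4(2)] tail_gf_eqI[OF 3(3)] \<psi>r_def)
qed

text \<open>A zero would give f_q(z) = 1, whereas |f_q(z)| <= f_q(|z|) < f_q(r) = 1 by nonnegativity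
  of the coefficients.\<close>

lemma cgf_f_qr_nonzero:
  assumes "norm z < r"
  shows "cgf f_qr z \<noteq> 0"
proof
  assume "cgf f_qr z = 0"
  then have "cgf f_q z = 1" using cgf_f_qr[OF assms] by simp
  then have "1 \<le> gf f_q (norm z)"
    using norm_cgf_le[of f_q z] f_q_nn summable_f_q[of "norm z"] assms by simp
  moreover have "gf f_q (norm z) < 1"
    using gf_f_qr[of "norm z"] gf_f_qr_pos[of "norm z"] assms
      mult_neg_pos[of "norm z - r" "gf f_qr (norm z)"] by simp
  ultimately show False by simp
qed

text \<open>The logarithmic derivative of \<open>K(z) / (z - q)\<close>.\<close>

definition "\<eta>c z = of_real \<gamma> / (of_real r - z) - \<psi>c z"
definition "\<eta> x = \<gamma> / (r - x) - \<psi>r x"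

lemma \<eta>c_of_real: "0 \<le> x \<Longrightarrow> x < r \<Longrightarrow> \<eta>c (of_real x) = of_real (\<eta> x)"
  by (simp add: \<eta>c_def \<eta>_def \<psi>c_of_real)

lemma \<eta>c_holomorphic: "\<eta>c holomorphic_on ball 0 r"
  unfolding \<eta>c_def \<psi>c_def
  by (intro holomorphic_intros cgf_holomorphic)
     (use f_qr_nn f_qqr_nn f_qrr_nn summable_f_qr summable_f_qqr summable_f_qrr
        cgf_f_qr_nonzero in auto)

text \<open>This is K' / K = - \<alpha> / (f - id) with the pole at q cleared, so that it also holds
  at x = q.\<close>

lemma \<eta>_key:
  assumes "0 \<le> x" "x < r"
  shows "(1 + (x - q) * \<eta> x) * ((r - x) * gf f_qr x) = \<alpha>"
proof -
  let ?C = "gf f_qr x" and ?A = "gf f_qqr x" and ?B = "gf f_qrr x"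
  have e1: "(x - r) * ?A = gf f_qq x - gf f_qq r"
    using gf_divdiff[OF f_qq_nn f_qq_sum_r, of r x] summable_f_qqr assms by simp
  have e2: "(x - q) * gf f_qq x = gf f_q x - (1 - \<alpha>)"
    using gf_divdiff[OF f_q_nn f_q_sum_r, of q x] q_bounds assms
      summable_gf_mono[OF f_qq_nn f_qq_sum_r, of x] by (simp add: gf_f_q_q)
  have e3: "(x - r) * ?B = ?C - gf f_qr r"
    using gf_divdiff[OF f_qr_nn f_qr_sum_r, of r x] summable_f_qrr assms by simp
  have e4: "(x - r) * ?C = gf f_q x - 1" using gf_f_qr assms by simp
  \<comment> \<open>The choice of \<gamma> makes these two values at r agree, both being \<alpha> /
    (r - q); they cancel in the combination \<open>?A - \<gamma> * ?B\<close>.\<close>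
  have g: "gf f_qq r = \<gamma> * gf f_qr r"
  proof -
    have "(r - q) * (\<gamma> * gf f_qr r) = \<gamma> * \<beta>" by (simp flip: gf_f_qr_r)
    also have "\<dots> = (r - q) * gf f_qq r"
      using \<beta>_pos by (simp add: gf_f_qq_r \<gamma>_def)
    finally have "(r - q) * (\<gamma> * gf f_qr r) = (r - q) * gf f_qq r" .
    then show ?thesis using q_bounds by simp
  qed
  have "(x - q) * ((x - r) * ?A - \<gamma> * ((x - r) * ?B)) = (x - q) * gf f_qq x - \<gamma> * (x - q) * ?C"
    unfolding e1 e3 g by (simp add: algebra_simps)
  also have "\<dots> = (x - r) * ?C + \<alpha> - \<gamma> * (x - q) * ?C"
    unfolding e2 using e4 by simp
  finally have N: "(x - q) * (r - x) * (?A - \<gamma> * ?B) = (r - x) * ?C + \<gamma> * (x - q) * ?C - \<alpha>"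
    by (simp add: algebra_simps)
  have "r - x \<noteq> 0" "?C \<noteq> 0" using assms gf_f_qr_pos[of x] by auto
  then have "(1 + (x - q) * \<eta> x) * ((r - x) * ?C) =
      (r - x) * ?C + \<gamma> * (x - q) * ?C - (x - q) * (r - x) * (?A - \<gamma> * ?B)"
    by (simp add: \<eta>_def \<psi>r_def field_simps)
  then show ?thesis unfolding N by simp
qed

lemma f_q_increment_tendsto:
  "((\<lambda>x. (gf f_q x - gf f_q q) / (x - q)) \<longlongrightarrow> gf (diffs f_q) q) (at_right q)"
proof -
  have "((\<lambda>x. (gf f_q x - gf f_q q) / (x - q)) \<longlongrightarrow> gf (diffs f_q) q) (at q)"
    using f_q_has_derivative[of q] q_bounds by (simp add: has_field_derivative_iff)
  then show ?thesis by (rule tendsto_within_subset) auto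
qed

lemma gf_f_q_tendsto: "(gf f_q \<longlongrightarrow> 1 - \<alpha>) (at_right q)"
proof -
  have "isCont (gf f_q) q"
    using DERIV_isCont[OF f_q_has_derivative[of q]] q_bounds by auto
  then show ?thesis
    by (auto simp: isCont_def gf_f_q_q intro: tendsto_within_subset)
qed

text \<open>Differentiating f = q + (x - q) f_q gives f' = f_q + (x - q) f_q'. The difference
  quotient of f' at q is then that of f_q plus f_q' itself, and each tends to f_q'(q). Limits are
  taken from the right because q may be 0.\<close>

lemma gf_diffs2_q: "gf (diffs (diffs p)) q = 2 * gf (diffs f_q) q"
proof -
  have s1: "summable (\<lambda>k. v k * x ^ k) \<Longrightarrow> summable (\<lambda>k. diffs v k * y ^ k)"
    if "\<bar>y\<bar> < x" for v :: "nat \<Rightarrow> real" and x y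
  proof -
    assume v: "summable (\<lambda>k. v k * x ^ k)"
    show ?thesis
      by (rule termdiff_converges[of y x]) (use that powser_inside[OF v] in auto)
  qed
  define m where "m = (q + r) / 2"
  have m: "q < m" "m < r" "0 \<le> m" using q_bounds by (auto simp: m_def)
  have d: "(gf (diffs v) has_real_derivative gf (diffs (diffs v)) q) (at q)"
    if "summable (\<lambda>k. v k * r ^ k)" for v :: "nat \<Rightarrow> real"
    by (rule gf_has_derivative[OF s1[OF _ that]]) (use m q_bounds in auto)
  have e: "eventually (\<lambda>x. x \<in> {q<..<r}) (at_right q)"
    using eventually_at_right_real[OF q_bounds(3)] .
  have f': "gf (diffs p) x = gf f_q x + (x - q) * gf (diffs f_q) x" if "x \<in> {q<..<r}" for x
  proof -
    have "((\<lambda>x. q + (x - q) * gf f_q x) has_real_derivative gf f_q x + (x - q) * gf (diffs f_q) x) (at x)"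
      using that q_bounds by (auto intro!: derivative_eq_intros f_q_has_derivative)
    moreover have "eventually (\<lambda>x. q + (x - q) * gf f_q x = gf p x) (nhds x)"
      using eventually_nhds_in_open[of "{q<..<r}" x] q_bounds that
      by (auto elim!: eventually_mono simp: gf_f_q)
    ultimately have "(gf p has_real_derivative gf f_q x + (x - q) * gf (diffs f_q) x) (at x)"
      by (simp add: DERIV_cong_ev)
    then show ?thesis
      using gf_diffs_has_derivative[of x] that q_bounds by (auto intro: DERIV_unique)
  qed
  have "isCont (gf (diffs f_q)) q"
    using DERIV_isCont[OF d[OF f_q_sum_r]] .
  then have "(gf (diffs f_q) \<longlongrightarrow> gf (diffs f_q) q) (at_right q)"
    by (auto simp: isCont_def intro: tendsto_within_subset)
  then have "((\<lambda>x. (gf f_q x - gf f_q q) / (x - q) + gf (diffs f_q) x) \<longlongrightarrow>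
      gf (diffs f_q) q + gf (diffs f_q) q) (at_right q)"
    by (intro tendsto_add f_q_increment_tendsto)
  moreover have "eventually (\<lambda>x. (gf f_q x - gf f_q q) / (x - q) + gf (diffs f_q) x =
      (gf (diffs p) x - gf (diffs p) q) / (x - q)) (at_right q)"
    using e by eventually_elim (use gf_f_q_q in \<open>auto simp: f' \<alpha>_def field_simps\<close>)
  ultimately have "((\<lambda>x. (gf (diffs p) x - gf (diffs p) q) / (x - q)) \<longlongrightarrow>
      gf (diffs f_q) q + gf (diffs f_q) q) (at_right q)"
    by (rule Lim_transform_eventually)
  moreover have "((\<lambda>x. (gf (diffs p) x - gf (diffs p) q) / (x - q)) \<longlongrightarrow>
      gf (diffs (diffs p)) q) (at q)"
    using d[OF p_sum_r] by (simp add: has_field_derivative_iff)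
  then have "((\<lambda>x. (gf (diffs p) x - gf (diffs p) q) / (x - q)) \<longlongrightarrow>
      gf (diffs (diffs p)) q) (at_right q)"
    by (rule tendsto_within_subset) auto
  ultimately show ?thesis
    using tendsto_unique[of "at_right q"] by fastforce
qed

lemma \<eta>_continuous_on: "continuous_on {0..<r} \<eta>"
proof -
  have "continuous_on {0..<r} (\<lambda>x. Re (\<eta>c (of_real x)))"
    by (intro continuous_intros continuous_on_compose2[OF
        holomorphic_on_imp_continuous_on[OF \<eta>c_holomorphic]]) auto
  then show ?thesis
    by (rule continuous_on_cong[THEN iffD1, rotated -1]) (auto simp: \<eta>c_of_real)
qed

text \<open>By \<open>\<eta>_key\<close> and \<alpha> = 1 - f_q(q), \<eta>(x) is the difference
  quotient of f_q at q divided by 1 - f_q(x). Its limit is the constant of the second-order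
  term.\<close>

lemma \<eta>_q: "\<eta> q = gf (diffs (diffs p)) q / (2 * \<alpha>)"
proof -
  have e: "eventually (\<lambda>x. x \<in> {q<..<r}) (at_right q)"
    using eventually_at_right_real[OF q_bounds(3)] .
  have "(\<eta> \<longlongrightarrow> \<eta> q) (at q within {0..<r})"
    using \<eta>_continuous_on q_bounds by (auto simp: continuous_on_def)
  then have "(\<eta> \<longlongrightarrow> \<eta> q) (at q within {q..(q + r) / 2})"
    by (rule tendsto_within_subset) (use q_bounds in auto)
  then have "(\<eta> \<longlongrightarrow> \<eta> q) (at_right q)"
    using q_bounds by (simp add: at_within_Icc_at_right)
  moreover have "((\<lambda>x. (gf f_q x - gf f_q q) / (x - q) / (1 - gf f_q x)) \<longlongrightarrow>
      gf (diffs f_q) q / (1 - (1 - \<alpha>))) (at_right q)"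
    by (intro tendsto_divide f_q_increment_tendsto tendsto_diff tendsto_const gf_f_q_tendsto)
       (use \<alpha>_pos in auto)
  then have "((\<lambda>x. (gf f_q x - gf f_q q) / (x - q) / (1 - gf f_q x)) \<longlongrightarrow>
      gf (diffs f_q) q / \<alpha>) (at_right q)" by simp
  then have "(\<eta> \<longlongrightarrow> gf (diffs f_q) q / \<alpha>) (at_right q)"
  proof (rule Lim_transform_eventually)
    show "eventually (\<lambda>x. (gf f_q x - gf f_q q) / (x - q) / (1 - gf f_q x) = \<eta> x) (at_right q)"
      using e
    proof eventually_elim
      case (elim x)
      then have x: "0 \<le> x" "x < r" "x \<noteq> q" using q_bounds by auto
      have C: "1 - gf f_q x = (r - x) * gf f_qr x"
        using gf_f_qr[OF x(1,2)] by (simp add: algebra_simps)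
      have "(1 + (x - q) * \<eta> x) * (1 - gf f_q x) = \<alpha>"
        unfolding C by (rule \<eta>_key[OF x(1,2)])
      moreover from C have "1 - gf f_q x \<noteq> 0" using x gf_f_qr_pos[of x] by simp
      ultimately show ?case
        using x by (simp add: gf_f_q_q divide_simps) (simp add: algebra_simps)
    qed
  qed
  ultimately have "\<eta> q = gf (diffs f_q) q / \<alpha>"
    using tendsto_unique[of "at_right q"] by fastforce
  then show ?thesis by (simp add: gf_diffs2_q)
qed

text \<open>\<open>\<eta>c\<close> has a primitive on the convex disc. Its restriction to the real
  segment gives H, and the Taylor coefficients at 0 of (z - q) times the exponential of the
  primitive give an expansion valid up to r, beyond the interval [0, 1] of the probabilistic
  argument.\<close>

lemma K_primitive:
  obtains H :: "real \<Rightarrow> real" and c :: "nat \<Rightarrow> real" where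
    "H q = 0"
    "\<And>x. x \<in> {0..<r} \<Longrightarrow> (H has_real_derivative \<eta> x) (at x within {0..<r})"
    "\<And>x. x \<in> {0..<r} \<Longrightarrow> (\<lambda>k. c k * x ^ k) sums ((x - q) * exp (H x))"
proof -
  obtain G where "\<And>z. z \<in> ball 0 r \<Longrightarrow> (G has_field_derivative \<eta>c z) (at z within ball 0 r)"
    using holomorphic_convex_primitive'[OF convex_ball open_ball \<eta>c_holomorphic] by blast
  then have G: "(G has_field_derivative \<eta>c z) (at z)" if "z \<in> ball 0 r" for z
    using that by (metis at_within_open open_ball)
  define Hc where "Hc z = G z - G (of_real q)" for z
  define H where "H x = Re (Hc (of_real x))" for x
  have Hc: "(Hc has_field_derivative \<eta>c z) (at z)" if "z \<in> ball 0 r" for z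
    unfolding Hc_def using G[OF that] by (auto intro!: derivative_eq_intros)
  have V: "((\<lambda>x. Hc (of_real x)) has_vector_derivative of_real (\<eta> x)) (at x within {0..<r})"
    if "x \<in> {0..<r}" for x
    using has_vector_derivative_real_field[of Hc "of_real (\<eta> x)" x "{0..<r}"] Hc[of "of_real x"] that
    by (simp add: \<eta>c_of_real)
  have H': "(H has_real_derivative \<eta> x) (at x within {0..<r})" if "x \<in> {0..<r}" for x
    using bounded_linear.has_vector_derivative[OF bounded_linear_Re V[OF that]]
    by (simp add: H_def [abs_def] has_real_derivative_iff_has_vector_derivative)
  have "((\<lambda>x. Im (Hc (of_real x))) has_real_derivative 0) (at x within {0..<r})" if "x \<in> {0..<r}" for x
    using bounded_linear.has_vector_derivative[OF bounded_linear_Im V[OF that]]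
    by (simp add: has_real_derivative_iff_has_vector_derivative)
  then obtain a where a: "\<And>x. x \<in> {0..<r} \<Longrightarrow> Im (Hc (of_real x)) = a"
    using has_field_derivative_zero_constant[of "{0..<r}" "\<lambda>x. Im (Hc (of_real x))"] by auto
  \<comment> \<open>The normalisation at q makes the constant imaginary part vanish, so the
    primitive is real on the real segment.\<close>
  have "a = 0" using a[of q] q_bounds by (simp add: Hc_def)
  then have Hr: "Hc (of_real x) = of_real (H x)" if "x \<in> {0..<r}" for x
    using a[OF that] by (simp add: H_def complex_eq_iff)
  define Kc where "Kc z = (z - of_real q) * exp (Hc z)" for z
  have "Hc holomorphic_on ball 0 r"
    using Hc by (subst holomorphic_on_open) blast+
  then have "Kc holomorphic_on ball 0 r"
    unfolding Kc_def by (intro holomorphic_intros)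
  note P = holomorphic_power_series[OF this]
  define c where "c n = Re ((deriv ^^ n) Kc 0 / fact n)" for n
  have "(\<lambda>k. c k * x ^ k) sums ((x - q) * exp (H x))" if x: "x \<in> {0..<r}" for x
  proof -
    have "(\<lambda>n. Re ((deriv ^^ n) Kc 0 / fact n * (of_real x - 0) ^ n)) sums Re (Kc (of_real x))"
      by (intro sums_Re P) (use x in auto)
    moreover have "Re ((deriv ^^ n) Kc 0 / fact n * (of_real x - 0) ^ n) = c n * x ^ n" for n
      unfolding diff_zero of_real_power[symmetric] c_def by (simp del: times_divide_eq_left of_real_power)
    moreover have "Kc (of_real x) = of_real ((x - q) * exp (H x))"
      by (simp add: Kc_def Hr[OF x] exp_of_real)
    ultimately show ?thesis
      by simp
  qed
  moreover have "H q = 0" by (simp add: H_def Hc_def)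
  ultimately show thesis using that H' by blast
qed

text \<open>A primitive of \<psi> is - \<gamma> ln (r - x) - H x. Its logarithmic boundary terms
  cancel the two powers in the definition of K, so that only exp (H s) remains.\<close>

lemma K_eq_exp:
  fixes \<psi> H :: "real \<Rightarrow> real"
  assumes "H q = 0"
    and H: "\<And>x. x \<in> {0..<r} \<Longrightarrow> (H has_real_derivative \<eta> x) (at x within {0..<r})"
    and \<psi>: "\<And>x. x \<in> {0..<r} \<Longrightarrow> \<psi> x = \<psi>r x"
    and s: "s \<in> {0..<r}"
  shows "(s - q) * (r - q) powr \<gamma> * (r - s) powr (-\<gamma>) * exp (LBINT x=s..q. \<psi> x) = (s - q) * exp (H s)"
proof -
  \<comment> \<open>The point s may lie on either side of q, hence the unordered interval.\<close>
  let ?I = "{min s q..max s q}"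
  have I: "?I \<subseteq> {0..<r}" using s q_bounds by auto
  have "continuous_on {0..<r} (\<lambda>x. \<gamma> / (r - x) - \<eta> x)"
    by (intro continuous_intros \<eta>_continuous_on) auto
  then have c: "continuous_on {0..<r} \<psi>r"
    by (simp add: \<eta>_def)
  have "(LBINT x=s..q. \<psi> x) = (- \<gamma> * ln (r - q) - H q) - (- \<gamma> * ln (r - s) - H s)"
  proof (rule interval_integral_FTC_finite)
    show "continuous_on ?I \<psi>"
      using continuous_on_subset[OF c I] I by (subst continuous_on_cong[OF refl \<psi>]) auto
    fix x assume "min s q \<le> x" "x \<le> max s q"
    then have x: "x \<in> {0..<r}" using I by auto
    have "((\<lambda>x. - \<gamma> * ln (r - x) - H x) has_real_derivative \<gamma> / (r - x) - \<eta> x) (at x within {0..<r})"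
      using x by (auto intro!: derivative_eq_intros H)
    then have "((\<lambda>x. - \<gamma> * ln (r - x) - H x) has_real_derivative \<psi> x) (at x within {0..<r})"
      using x \<psi> by (simp add: \<eta>_def)
    then show "((\<lambda>x. - \<gamma> * ln (r - x) - H x) has_vector_derivative \<psi> x) (at x within ?I)"
      unfolding has_real_derivative_iff_has_vector_derivative
      by (rule has_vector_derivative_within_subset[OF _ I])
  qed
  then have "exp (LBINT x=s..q. \<psi> x) = exp (- \<gamma> * ln (r - q)) * exp (\<gamma> * ln (r - s)) * exp (H s)"
    using \<open>H q = 0\<close> by (simp flip: exp_add)
  moreover have "(r - q) powr \<gamma> = exp (\<gamma> * ln (r - q))" "(r - s) powr (-\<gamma>) = exp (- \<gamma> * ln (r - s))"
    using s q_bounds by (auto simp: powr_def)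
  ultimately show ?thesis
    by (simp add: mult.assoc mult.left_commute flip: exp_add)
qed

text \<open>K multiplied by exp (\<alpha> t) is a constant of motion: by \<open>\<eta>_key\<close>
  its derivative along G' = f(G) - G vanishes. The product form, unlike a logarithm, stays
  meaningful when G t = q.\<close>

lemma flow_invariant:
  fixes H G :: "real \<Rightarrow> real"
  assumes H: "\<And>x. x \<in> {0..<r} \<Longrightarrow> (H has_real_derivative \<eta> x) (at x within {0..<r})"
    and G: "\<And>t. t \<ge> 0 \<Longrightarrow> G t \<in> {0..1}"
      "\<And>t. t \<ge> 0 \<Longrightarrow> (G has_real_derivative (gf p (G t) - G t)) (at t within {0..})"
    and t: "t \<ge> 0"
  shows "(G t - q) * exp (H (G t)) = exp (-\<alpha> * t) * ((G 0 - q) * exp (H (G 0)))"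
proof -
  let ?Q = "\<lambda>t. exp (\<alpha> * t) * ((G t - q) * exp (H (G t)))"
  have "(?Q has_real_derivative 0) (at u within {0..})" if u: "u \<in> {0..}" for u
  proof -
    let ?x = "G u"
    have x: "?x \<in> {0..<r}" "0 \<le> ?x" "?x < r" using G(1)[of u] u r_gt_1 by auto
    have HG: "((\<lambda>u. H (G u)) has_real_derivative (gf p ?x - ?x) * \<eta> ?x) (at u within {0..})"
      using DERIV_chain_s[of "{0..<r}" H \<eta> G] 
        DERIV_image_chain[OF has_field_derivative_subset[OF H[OF x(1)], of "G ` {0..}"] G(2)] G(1) u r_gt_1
      by (force simp: o_def mult.commute)
    have "(?Q has_real_derivative exp (\<alpha> * u) * exp (H ?x) *
        (\<alpha> * (?x - q) + (1 + (?x - q) * \<eta> ?x) * (gf p ?x - ?x))) (at u within {0..})"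
      using u by (auto intro!: derivative_eq_intros HG G(2) simp: algebra_simps)
    moreover have "(1 + (?x - q) * \<eta> ?x) * (gf p ?x - ?x) = - \<alpha> * (?x - q)"
      unfolding gf_p_factor[OF x(2,3)] \<eta>_key[OF x(2,3), symmetric] by (simp add: algebra_simps)
    ultimately show ?thesis by simp
  qed
  then obtain c where "\<And>u. u \<in> {0..} \<Longrightarrow> ?Q u = c"
    using has_field_derivative_zero_constant[of "{0..}" ?Q] by auto
  from this[of t] this[of 0] t have "?Q t = (G 0 - q) * exp (H (G 0))" by simp
  then show ?thesis
    by (simp add: exp_minus field_simps)
qed

end

section \<open>Modified linear-fractional offspring laws\<close>

text \<open>The Gauss limit for the reciprocal Gamma function, renormalised. Both index shifts are
  stated against the same power of n + 1 because the coefficients of K combine neighbouring terms of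
  the binomial series.\<close>

lemma pochhammer_fact_asymp:
  fixes g :: real
  assumes g: "g > 0"
  shows "(\<lambda>n. pochhammer g (Suc n) / fact (Suc n) / real (Suc n) powr (g - 1)) \<longlonglongrightarrow> rGamma g"
    and "(\<lambda>n. pochhammer g n / fact n / real (Suc n) powr (g - 1)) \<longlonglongrightarrow> rGamma g"
proof -
  have "(\<lambda>n. (real n / real (Suc n)) powr g) \<longlonglongrightarrow> 1"
    by real_asymp
  from tendsto_mult[OF rGamma_series_LIMSEQ[of g] this]
  have "(\<lambda>n. rGamma_series g n * (real n / real (Suc n)) powr g) \<longlonglongrightarrow> rGamma g" by simp
  moreover have "eventually (\<lambda>n. rGamma_series g n * (real n / real (Suc n)) powr g =
      pochhammer g (Suc n) / fact (Suc n) / real (Suc n) powr (g - 1)) sequentially"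
    using eventually_gt_at_top[of 0]
  proof eventually_elim
    case (elim n)
    have "rGamma_series g n = pochhammer g (Suc n) / (fact n * real n powr g)"
      using elim by (simp add: rGamma_series_def powr_def)
    moreover have "(real n / real (Suc n)) powr g = real n powr g / real (Suc n) powr g"
      by (simp add: powr_divide)
    moreover have "real (Suc n) powr (g - 1) = real (Suc n) powr g / real (Suc n)"
      by (simp add: powr_diff)
    moreover have "real n powr g \<noteq> 0" "real (Suc n) powr g \<noteq> 0" using elim by auto
    ultimately show ?case by (simp add: field_simps del: of_nat_Suc pochhammer_Suc)
  qed
  ultimately show 1: "(\<lambda>n. pochhammer g (Suc n) / fact (Suc n) / real (Suc n) powr (g - 1)) \<longlonglongrightarrow> rGamma g"
    by (rule Lim_transform_eventually)
  have "(\<lambda>n. real (Suc n) / (g + real n)) \<longlonglongrightarrow> 1"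
    by real_asymp
  from tendsto_mult[OF 1 this]
  have "(\<lambda>n. pochhammer g (Suc n) / fact (Suc n) / real (Suc n) powr (g - 1) * (real (Suc n) / (g + real n)))
      \<longlonglongrightarrow> rGamma g" by simp
  moreover have "pochhammer g (Suc n) / fact (Suc n) / real (Suc n) powr (g - 1) * (real (Suc n) / (g + real n)) =
      pochhammer g n / fact n / real (Suc n) powr (g - 1)" for n
  proof -
    have "g + real n \<noteq> 0" using g by (smt (verit) of_nat_0_le_iff)
    moreover have "pochhammer g (Suc n) / fact (Suc n) =
        pochhammer g n / fact n * ((g + real n) / real (Suc n))"
      by (simp add: pochhammer_Suc)
    ultimately show ?thesis by (simp del: of_nat_Suc pochhammer_Suc fact_Suc)
  qed
  ultimately show "(\<lambda>n. pochhammer g n / fact n / real (Suc n) powr (g - 1)) \<longlonglongrightarrow> rGamma g"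
    by simp
qed

lemma divdiff_geometric:
  assumes v: "\<And>j. v (Suc (j + m)) = d * a ^ j" and y: "\<bar>a * y\<bar> < 1"
  shows "divdiff y v m = d / (1 - a * y)"
proof -
  have "(\<lambda>j. d * (a * y) ^ j) sums (d * (1 / (1 - a * y)))"
    by (intro sums_mult geometric_sums) (use y in auto)
  then show ?thesis
    by (simp add: divdiff_def gf_def v power_mult_distrib mult.assoc sums_iff)
qed

text \<open>The law is given through its generating function only; uniqueness of power series turns
  this into geometric coefficients from index 2 on.\<close>

lemma modified_linear_fractional_coeffs:
  assumes "modified_linear_fractional v"
  obtains a d where "0 \<le> a" "\<And>k. v (Suc (Suc k)) = d * a ^ k"
proof -
  obtain p0 p1 pD a where a: "0 \<le> a" "a < 1"
    and s: "\<And>s. 0 \<le> s \<Longrightarrow> a * s < 1 \<Longrightarrow>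
      (\<lambda>k. v k * s ^ k) sums (p0 + p1 * s + (1 - p0 - p1 - pD) * s\<^sup>2 * (1 - a) / (1 - a * s))"
  proof -
    from assms obtain p0 p1 pD a where
      "{p0, p1, pD, a} \<subseteq> {0..<1}" and
      "\<forall>s. 0 \<le> s \<and> a * s < 1 \<longrightarrow>
        (\<lambda>k. v k * s ^ k) sums (p0 + p1 * s + (1 - p0 - p1 - pD) * s\<^sup>2 * (1 - a) / (1 - a * s))"
      unfolding modified_linear_fractional_def by blast
    then show thesis by (intro that[of a p0 p1 pD]) auto
  qed
  define d where "d = (1 - p0 - p1 - pD) * (1 - a)"
  define w where "w k = (case k of 0 \<Rightarrow> p0 | Suc 0 \<Rightarrow> p1 | Suc (Suc j) \<Rightarrow> d * a ^ j)" for k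
  have "v = w"
  proof (rule power_series_unique[OF zero_less_one])
    fix x :: real assume x: "0 < x" "x < 1"
    have "a * x \<le> 1 * x" using a x by (intro mult_right_mono) auto
    then have ax: "a * x < 1" using x by linarith
    have ax': "0 \<le> a * x" using a x by simp
    show "(\<lambda>k. v k * x ^ k) sums (p0 + p1 * x + d * x\<^sup>2 / (1 - a * x))"
      using s[of x] x ax by (simp add: d_def mult_ac)
    have "(\<lambda>j. d * x\<^sup>2 * (a * x) ^ j) sums (d * x\<^sup>2 * (1 / (1 - a * x)))"
      by (intro sums_mult geometric_sums) (use ax ax' in auto)
    then have "(\<lambda>j. w (Suc (Suc j)) * x ^ Suc (Suc j)) sums (d * x\<^sup>2 / (1 - a * x))"
      by (simp add: w_def power_mult_distrib power2_eq_square mult_ac)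
    then have "(\<lambda>j. w (Suc j) * x ^ Suc j) sums (d * x\<^sup>2 / (1 - a * x) + w (Suc 0) * x ^ Suc 0)"
      by (rule sums_Suc)
    then have "(\<lambda>j. w j * x ^ j) sums (d * x\<^sup>2 / (1 - a * x) + w (Suc 0) * x ^ Suc 0 + w 0 * x ^ 0)"
      by (rule sums_Suc)
    then show "(\<lambda>j. w j * x ^ j) sums (p0 + p1 * x + d * x\<^sup>2 / (1 - a * x))"
      by (simp add: w_def algebra_simps)
  qed
  then have "v (Suc (Suc k)) = d * a ^ k" for k by (simp add: w_def)
  with a show thesis by (intro that) auto
qed

context extendable_gf
begin

text \<open>Divided differences of a geometric sequence are multiples of the same sequence, so the
  two terms in the numerator of \<psi> are proportional. Comparison of values at r shows the factor
  to be exactly \<gamma>.\<close>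

lemma \<psi>r_modified_linear_fractional:
  assumes "modified_linear_fractional p" "0 \<le> x" "x < r"
  shows "\<psi>r x = 0"
proof -
  obtain a d where a: "0 \<le> a" and p: "\<And>k. p (Suc (Suc k)) = d * a ^ k"
    using modified_linear_fractional_coeffs[OF assms(1)] by metis
  have nl: "\<exists>k. p (Suc (Suc k)) \<noteq> 0"
  proof (rule ccontr)
    assume "\<not> (\<exists>k. p (Suc (Suc k)) \<noteq> 0)"
    then have "f_q (Suc m) = 0" for m by (simp add: divdiff_def gf_def)
    then have "f_qr 0 = 0" by (simp add: divdiff_def[of r] gf_def)
    then show False using f_qr_0_pos by simp
  qed
  then have d: "d \<noteq> 0" using p by auto
  \<comment> \<open>Convergence of the geometric tail at r puts r strictly inside the disc of
    convergence.\<close>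
  have ar: "a * r < 1"
  proof -
    have "summable (\<lambda>k. p (Suc (Suc k)) * r ^ Suc (Suc k))"
      using p_sum_r by (simp only: summable_Suc_iff[of "\<lambda>k. p k * r ^ k"] summable_Suc_iff[of "\<lambda>k. p (Suc k) * r ^ Suc k"])
    then have "summable (\<lambda>k. (d * r\<^sup>2) * (a * r) ^ k)"
      by (simp add: p power_mult_distrib power2_eq_square mult_ac)
    then have "summable (\<lambda>k. (a * r) ^ k)"
      using d q_bounds by (subst (asm) summable_cmult_iff) simp
    then show ?thesis using a q_bounds by (simp add: summable_geometric_iff)
  qed
  moreover have "a * q \<le> a * r" using a q_bounds by (intro mult_left_mono) auto
  ultimately have abs: "\<bar>a * q\<bar> < 1" "\<bar>a * r\<bar> < 1" and nz: "1 - a * q > 0" "1 - a * r > 0"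
    using a q_bounds by auto
  have fq: "f_q (Suc m) = d * a ^ m / (1 - a * q)" for m
    by (rule divdiff_geometric[OF _ abs(1)]) (simp add: p power_add mult_ac)
  have fqr: "f_qr m = d * a ^ m / (1 - a * q) / (1 - a * r)" for m
    by (rule divdiff_geometric[OF _ abs(2)]) (simp add: fq power_add mult_ac)
  have fqq: "f_qq m = d * a ^ m / (1 - a * q) / (1 - a * q)" for m
    by (rule divdiff_geometric[OF _ abs(1)]) (simp add: fq power_add mult_ac)
  have fqqr: "f_qqr m = d * a ^ Suc m / (1 - a * q) / (1 - a * q) / (1 - a * r)" for m
    by (rule divdiff_geometric[OF _ abs(2)]) (simp add: fqq power_add mult_ac)
  have fqrr: "f_qrr m = d * a ^ Suc m / (1 - a * q) / (1 - a * r) / (1 - a * r)" for m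
    by (rule divdiff_geometric[OF _ abs(2)]) (simp add: fqr power_add mult_ac)
  have e: "f_qq = (\<lambda>m. (1 - a * r) / (1 - a * q) * f_qr m)"
    using nz by (auto simp: fqq fqr)
  have "\<gamma> * \<beta> = (r - q) * gf f_qq r"
    using \<beta>_pos by (simp add: gf_f_qq_r \<gamma>_def)
  also have "gf f_qq r = (1 - a * r) / (1 - a * q) * gf f_qr r"
    by (subst e) (rule gf_cmult[OF f_qr_sum_r])
  also have "(r - q) * \<dots> = (1 - a * r) / (1 - a * q) * \<beta>"
    unfolding gf_f_qr_r[symmetric] by (simp only: mult.left_commute)
  finally have "\<gamma> * \<beta> = (1 - a * r) / (1 - a * q) * \<beta>" .
  then have g: "\<gamma> = (1 - a * r) / (1 - a * q)" using \<beta>_pos by (metis less_irrefl mult_right_cancel)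
  have e': "f_qqr = (\<lambda>m. \<gamma> * f_qrr m)"
    using nz by (auto simp: g fqqr fqrr)
  have "gf f_qqr x = \<gamma> * gf f_qrr x"
    by (subst e') (rule gf_cmult[OF summable_f_qrr[OF assms(2,3)]])
  then show ?thesis by (simp add: \<psi>r_def)
qed

text \<open>The coefficients come from the binomial series of \<open>(r - s) powr (- \<gamma>)\<close>.\<close>

lemma linear_fractional_coeffs_asymp:
  assumes c: "\<And>s. s \<in> {0..<r} \<Longrightarrow> (\<lambda>k. c k * s ^ k) sums ((s - q) * (r - q) powr \<gamma> * (r - s) powr (-\<gamma>))"
  shows "c \<sim>[at_top] (\<lambda>k. ((r - q) powr \<gamma> * r powr (-\<gamma>) * (r - q) * rGamma \<gamma>) *
    real k powr (\<gamma> - 1) * r powr (- real k))"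
proof -
  define P where "P n = pochhammer \<gamma> n / fact n" for n
  define A where "A = (r - q) powr \<gamma> * r powr (-\<gamma>)"
  define b where "b n = A * P n / r ^ n" for n
  have A: "A > 0" using q_bounds by (simp add: A_def)
  have B: "(\<lambda>n. b n * s ^ n) sums ((r - q) powr \<gamma> * (r - s) powr (-\<gamma>))" if "0 < s" "s < r" for s
  proof -
    have "(\<lambda>n. (- \<gamma> gchoose n) * r powr (- \<gamma> - of_nat n) * (- s) ^ n) sums (r + - s) powr (- \<gamma>)"
      by (rule gen_binomial_real'') (use that in auto)
    note * = sums_mult[OF this, of "(r - q) powr \<gamma>"]
    have "(r - q) powr \<gamma> * ((- \<gamma> gchoose n) * r powr (- \<gamma> - of_nat n) * (- s) ^ n) = b n * s ^ n" for n
    proof -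
      have "(- \<gamma> gchoose n) * (- s) ^ n = P n * s ^ n"
      proof -
        have "((- 1) ^ n * (- 1) ^ n :: real) = 1" by (simp flip: power_mult_distrib)
        moreover have "(- \<gamma> gchoose n) * (- s) ^ n = ((- 1) ^ n * (- 1) ^ n) * (P n * s ^ n)"
          by (subst power_minus) (simp only: P_def gbinomial_pochhammer minus_minus times_divide_eq_left
            times_divide_eq_right mult_ac)
        ultimately show ?thesis by simp
      qed
      moreover have "r powr (- \<gamma> - of_nat n) = r powr (-\<gamma>) / r ^ n"
        using q_bounds by (simp add: powr_diff powr_realpow)
      moreover have "(r - q) powr \<gamma> * ((- \<gamma> gchoose n) * r powr (- \<gamma> - of_nat n) * (- s) ^ n) =
          (r - q) powr \<gamma> * r powr (- \<gamma> - of_nat n) * ((- \<gamma> gchoose n) * (- s) ^ n)"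
        by simp
      ultimately show ?thesis
        by (simp add: b_def A_def)
    qed
    with * show ?thesis by simp
  qed
  \<comment> \<open>Multiplication by s - q combines neighbouring coefficients of the binomial
    series.\<close>
  define e where "e k = (case k of 0 \<Rightarrow> - q * b 0 | Suc n \<Rightarrow> b n - q * b (Suc n))" for k
  have "c = e"
  proof (rule power_series_unique[OF q_bounds(4)])
    fix s assume s: "0 < s" "s < r"
    let ?V = "(r - q) powr \<gamma> * (r - s) powr (-\<gamma>)"
    show "(\<lambda>k. c k * s ^ k) sums ((s - q) * ?V)"
      using c[of s] s by (simp add: mult.assoc)
    have "(\<lambda>n. b (Suc n) * s ^ Suc n) sums (?V - b 0 * s ^ 0)"
      using B[OF s] by (subst sums_Suc_iff) simp
    from sums_diff[OF sums_mult[OF B[OF s], of s] sums_mult[OF this, of q]]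
    have "(\<lambda>n. e (Suc n) * s ^ Suc n) sums (s * ?V - q * (?V - b 0))"
      by (simp add: e_def algebra_simps)
    then have "(\<lambda>n. e n * s ^ n) sums (s * ?V - q * (?V - b 0) + e 0 * s ^ 0)"
      by (rule sums_Suc)
    then show "(\<lambda>k. e k * s ^ k) sums ((s - q) * ?V)"
      by (simp add: e_def algebra_simps)
  qed
  let ?C = "A * (r - q) * rGamma \<gamma>"
  have rG: "rGamma \<gamma> > 0" using \<gamma>_pos Gamma_real_pos[of \<gamma>] by (simp add: rGamma_inverse_Gamma)
  \<comment> \<open>Each \<open>P n\<close> is asymptotic to rGamma \<gamma> times n powr (\<gamma>
    - 1), and the weights r and - q of the neighbouring terms leave the factor r - q.\<close>
  have "(\<lambda>n. A * (r * (P n / real (Suc n) powr (\<gamma> - 1)) - q * (P (Suc n) / real (Suc n) powr (\<gamma> - 1))))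
      \<longlonglongrightarrow> A * (r * rGamma \<gamma> - q * rGamma \<gamma>)"
    unfolding P_def by (intro tendsto_intros pochhammer_fact_asymp \<gamma>_pos)
  then have "(\<lambda>n. A * (r * (P n / real (Suc n) powr (\<gamma> - 1)) - q * (P (Suc n) / real (Suc n) powr (\<gamma> - 1))) / ?C)
      \<longlonglongrightarrow> A * (r * rGamma \<gamma> - q * rGamma \<gamma>) / ?C"
    by (rule tendsto_divide[OF _ tendsto_const]) (use A q_bounds rG in auto)
  also have "A * (r * rGamma \<gamma> - q * rGamma \<gamma>) / ?C = 1"
    using A q_bounds rG by (simp add: field_simps)
  finally have "(\<lambda>n. A * (r * (P n / real (Suc n) powr (\<gamma> - 1)) - q * (P (Suc n) / real (Suc n) powr (\<gamma> - 1))) / ?C) \<longlonglongrightarrow> 1" .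
  moreover have "A * (r * (P n / real (Suc n) powr (\<gamma> - 1)) - q * (P (Suc n) / real (Suc n) powr (\<gamma> - 1))) / ?C =
      c (Suc n) / (?C * real (Suc n) powr (\<gamma> - 1) * r powr (- real (Suc n)))" for n
  proof -
    have rp: "r powr (- real (Suc n)) = 1 / r ^ Suc n"
      using q_bounds by (simp only: powr_minus_divide powr_realpow)
    have "c (Suc n) * r ^ Suc n = A * (r * P n - q * P (Suc n))"
      using q_bounds by (simp add: \<open>c = e\<close> e_def b_def field_simps)
    moreover have "c (Suc n) / (?C * real (Suc n) powr (\<gamma> - 1) * r powr (- real (Suc n))) =
        (c (Suc n) * r ^ Suc n) / (?C * real (Suc n) powr (\<gamma> - 1))"
      unfolding rp by simp
    moreover have "A * (r * (x / w) - q * (y / w)) / C' = A * (r * x - q * y) / (C' * w)" for x y w C' :: real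
    proof -
      have "r * (x / w) - q * (y / w) = (r * x - q * y) / w" by (simp add: diff_divide_distrib)
      then show ?thesis by (simp add: mult.commute)
    qed
    ultimately show ?thesis by metis
  qed
  ultimately have "(\<lambda>n. c (Suc n) / (?C * real (Suc n) powr (\<gamma> - 1) * r powr (- real (Suc n)))) \<longlonglongrightarrow> 1"
    by simp
  then have lim: "(\<lambda>k. c k / (?C * real k powr (\<gamma> - 1) * r powr (- real k))) \<longlonglongrightarrow> 1"
    by (rule LIMSEQ_imp_Suc)
  show ?thesis
    using lim by (intro asymp_equivI') (simp add: A_def mult.assoc)
qed

end

section \<open>The family tree\<close>

lemma death_time_child: "death_time L u \<omega> = birth_time L (i # u) \<omega>"
  by (simp add: death_time_def)

text \<open>Labels list the line of descent from the individual back to the root, so the child i of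
  the root and its descendants are the lists ending in i. Composing L and X with
  \<open>\<lambda>u. u @ [i]\<close> therefore restarts the process at that child.\<close>

lemma birth_time_snoc:
  "birth_time L (v @ [i]) \<omega> = L [] \<omega> + birth_time (\<lambda>u. L (u @ [i])) v \<omega>"
  by (induction v) auto

lemma death_time_snoc:
  "death_time L (v @ [i]) \<omega> = L [] \<omega> + death_time (\<lambda>u. L (u @ [i])) v \<omega>"
  by (simp add: death_time_def birth_time_snoc)

lemma death_time_root: "death_time L [] \<omega> = L [] \<omega>"
  by (simp add: death_time_def)

lemma realized_snoc:
  "realized X (v @ [i]) \<omega> \<longleftrightarrow> (\<exists>k. X [] \<omega> = Some k \<and> i < k) \<and> realized (\<lambda>u. X (u @ [i])) v \<omega>"
  by (induction v) auto

lemma birth_time_nonneg: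
  assumes "\<And>u. L u \<omega> > 0"
  shows "birth_time L u \<omega> \<ge> 0"
  by (induction u) (use assms in \<open>auto intro: add_nonneg_nonneg less_imp_le\<close>)

lemma death_time_ge_root:
  assumes "\<And>u. L u \<omega> > 0"
  shows "L [] \<omega> \<le> death_time L u \<omega>"
proof (cases u rule: rev_cases)
  case (snoc v i)
  have "birth_time (\<lambda>u. L (u @ [i])) v \<omega> \<ge> 0"
    by (rule birth_time_nonneg) (rule assms)
  then show ?thesis
    using assms[of "v @ [i]"] by (simp add: snoc death_time_snoc) (simp add: death_time_def)
qed (simp add: death_time_def)

lemma ex_list_rev_conv: "(\<exists>u. P u) \<longleftrightarrow> P [] \<or> (\<exists>v i. P (v @ [i]))"
  by (metis rev_exhaust)

definition graveyard :: "(nat list \<Rightarrow> 'w \<Rightarrow> real) \<Rightarrow> (nat list \<Rightarrow> 'w \<Rightarrow> nat option) \<Rightarrow> real \<Rightarrow> 'w \<Rightarrow> bool" where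
  "graveyard L X t \<omega> \<longleftrightarrow> (\<exists>u. realized X u \<omega> \<and> X u \<omega> = None \<and> death_time L u \<omega> \<le> t)"

lemma Z_eq: "Z L X t \<omega> = (if graveyard L X t \<omega> then None
   else if finite (alive L X t \<omega>) then Some (enat (card (alive L X t \<omega>))) else Some \<infinity>)"
  by (simp add: Z_def graveyard_def)

lemma graveyard_mono: "graveyard L X s \<omega> \<Longrightarrow> s \<le> t \<Longrightarrow> graveyard L X t \<omega>"
  unfolding graveyard_def by force

lemma Z_before_root_death:
  assumes "\<And>u. L u \<omega> > 0" "0 \<le> t" "t < L [] \<omega>"
  shows "Z L X t \<omega> = Some 1"
proof -
  have "\<not> graveyard L X t \<omega>"
    using order.strict_trans2[OF assms(3) death_time_ge_root[of L \<omega>]] assms(1)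
    by (auto simp: graveyard_def not_le)
  moreover have "alive L X t \<omega> = {[]}"
  proof -
    have "u = []" if "birth_time L u \<omega> \<le> t" for u
    proof (cases u)
      case (Cons i v)
      then have "death_time L v \<omega> \<le> t" using that death_time_child[of L v \<omega> i] by simp
      then show ?thesis using death_time_ge_root[of L \<omega> v] assms by simp
    qed
    then show ?thesis using assms by (auto simp: alive_def death_time_def)
  qed
  ultimately show ?thesis by (simp add: Z_eq one_enat_def)
qed

lemma graveyard_after_root_death:
  assumes "L [] \<omega> \<le> t"
  shows "graveyard L X t \<omega> \<longleftrightarrow> X [] \<omega> = None \<or>
    (\<exists>k. X [] \<omega> = Some k \<and> (\<exists>i<k. graveyard (\<lambda>u. L (u @ [i])) (\<lambda>u. X (u @ [i])) (t - L [] \<omega>) \<omega>))"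
  unfolding graveyard_def
  apply (subst ex_list_rev_conv)
  using assms by (auto simp: realized_snoc death_time_snoc death_time_root algebra_simps)

lemma alive_after_root_death:
  assumes "L [] \<omega> \<le> t" "X [] \<omega> = Some k"
  shows "alive L X t \<omega> =
    (\<Union>i<k. (\<lambda>v. v @ [i]) ` alive (\<lambda>u. L (u @ [i])) (\<lambda>u. X (u @ [i])) (t - L [] \<omega>) \<omega>)"
    (is "_ = ?R")
proof -
  have "u \<in> alive L X t \<omega> \<longleftrightarrow> u \<in> ?R" for u
    by (cases u rule: rev_cases)
       (use assms in \<open>auto simp: alive_def realized_snoc birth_time_snoc death_time_snoc death_time_def algebra_simps\<close>)
  then show ?thesis by blast
qed

text \<open>The value 0 at the graveyard and the two values at \<infinity> make the weight
  multiplicative over subtrees even when a population is infinite. At s = 1 it is the indicator of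
  having avoided the graveyard, at s = 0 the indicator of extinction.\<close>

definition pgf_weight :: "real \<Rightarrow> enat option \<Rightarrow> real" where
  "pgf_weight s z = (case z of None \<Rightarrow> 0 | Some n \<Rightarrow>
     (case n of enat k \<Rightarrow> s ^ k | \<infinity> \<Rightarrow> if s = 1 then 1 else 0))"

lemma pgf_weight_bounds: "0 \<le> s \<Longrightarrow> s \<le> 1 \<Longrightarrow> pgf_weight s z \<in> {0..1}"
  by (auto simp: pgf_weight_def power_le_one split: option.splits enat.splits)

text \<open>After the root's death the population is the disjoint union of the subtree populations,
  and the graveyard is entered as soon as one subtree enters it.\<close>

lemma pgf_weight_branch:
  assumes "L [] \<omega> \<le> t" "X [] \<omega> = Some k"
  shows "pgf_weight s (Z L X t \<omega>) =
    (\<Prod>i<k. pgf_weight s (Z (\<lambda>u. L (u @ [i])) (\<lambda>u. X (u @ [i])) (t - L [] \<omega>) \<omega>))"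
proof -
  let ?L = "\<lambda>i u. L (u @ [i])" and ?X = "\<lambda>i u. X (u @ [i])" and ?t = "t - L [] \<omega>"
  let ?A = "\<lambda>i. alive (?L i) (?X i) ?t \<omega>"
  have al: "alive L X t \<omega> = (\<Union>i<k. (\<lambda>v. v @ [i]) ` ?A i)"
    by (rule alive_after_root_death) fact+
  have gr: "graveyard L X t \<omega> \<longleftrightarrow> (\<exists>i<k. graveyard (?L i) (?X i) ?t \<omega>)"
    using graveyard_after_root_death[of L \<omega> t X] assms by simp
  have inj: "inj_on (\<lambda>v. v @ [i]) B" for i :: nat and B by (auto simp: inj_on_def)
  consider "graveyard L X t \<omega>" | "\<not> graveyard L X t \<omega>" "\<forall>i<k. finite (?A i)"
    | i where "\<not> graveyard L X t \<omega>" "i < k" "infinite (?A i)" by blast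
  then show ?thesis
  proof cases
    case 1
    then have "\<exists>i\<in>{..<k}. pgf_weight s (Z (?L i) (?X i) ?t \<omega>) = 0"
      by (auto simp: gr Z_eq pgf_weight_def)
    then show ?thesis using 1 by (subst prod_zero) (auto simp: Z_eq pgf_weight_def)
  next
    case 2
    have "card (alive L X t \<omega>) = (\<Sum>i<k. card (?A i))"
      unfolding al using 2(2) by (subst card_UN_disjoint) (auto simp: card_image[OF inj])
    moreover have "finite (alive L X t \<omega>)" unfolding al using 2 by auto
    moreover have "\<forall>i<k. \<not> graveyard (?L i) (?X i) ?t \<omega>" using 2(1) gr by blast
    ultimately show ?thesis using 2
      by (simp add: Z_eq pgf_weight_def power_sum)
  next
    case 3
    have "infinite (alive L X t \<omega>)"
    proof
      assume "finite (alive L X t \<omega>)"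
      then have "finite ((\<lambda>v. v @ [i]) ` ?A i)"
        by (rule rev_finite_subset) (use 3(2) al in blast)
      then show False using 3(3) finite_imageD[OF _ inj] by blast
    qed
    then have "Z L X t \<omega> = Some \<infinity>" "\<forall>j<k. Z (?L j) (?X j) ?t \<omega> \<noteq> None" "Z (?L i) (?X i) ?t \<omega> = Some \<infinity>"
      using 3 by (auto simp: Z_eq gr)
    note Z = this
    show ?thesis
    proof (cases "s = 1")
      case True
      have "pgf_weight s z = 1" if "z \<noteq> None" for z
        using that True by (auto simp: pgf_weight_def split: enat.splits)
      then show ?thesis using Z by simp
    next
      case False
      then have "pgf_weight s (Some \<infinity>) = 0" by (simp add: pgf_weight_def)
      then have "\<exists>j\<in>{..<k}. pgf_weight s (Z (?L j) (?X j) ?t \<omega>) = 0"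
        using Z 3(2) by (intro bexI[of _ i]) simp_all
      then show ?thesis
        using Z \<open>pgf_weight s (Some \<infinity>) = 0\<close> by (subst prod_zero) auto
    qed
  qed
qed

text \<open>
  Take the first particle in the line of descent that dies after \<open>s\<close>. Life lengths may be
  nonpositive here, so the event \<open>T > t\<close> is measurable without discarding a null set.
\<close>

lemma ancestor_alive:
  assumes "realized X u \<omega>" "0 \<le> s" "s < death_time L u \<omega>"
  shows "alive L X s \<omega> \<noteq> {}"
  using assms
proof (induction u)
  case Nil
  then have "[] \<in> alive L X s \<omega>" by (simp add: alive_def)
  then show ?case by blast
next
  case (Cons i u)
  show ?case
  proof (cases "birth_time L (i # u) \<omega> \<le> s")
    case True
    then have "i # u \<in> alive L X s \<omega>" using Cons.prems unfolding alive_def by blast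
    then show ?thesis by blast
  next
    case False
    then show ?thesis
      using Cons.prems Cons.IH by (auto simp: death_time_def)
  qed
qed

lemma Z_eq_0_iff: "Z L X t \<omega> = Some 0 \<longleftrightarrow> \<not> graveyard L X t \<omega> \<and> alive L X t \<omega> = {}"
  by (auto simp: Z_eq zero_enat_def)

lemma Z_eq_None_iff: "Z L X t \<omega> = None \<longleftrightarrow> graveyard L X t \<omega>"
  by (auto simp: Z_eq)

lemma absorbed_mono:
  assumes "Z L X s \<omega> \<in> {None, Some 0}" "0 \<le> s" "s \<le> t"
  shows "Z L X t \<omega> \<in> {None, Some 0}"
proof (cases "graveyard L X t \<omega>")
  case False
  then have "alive L X s \<omega> = {}"
    using assms graveyard_mono[of L X s \<omega> t] by (auto simp: Z_eq_0_iff Z_eq_None_iff)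
  then have "alive L X t \<omega> = {}"
    using ancestor_alive[of X _ \<omega> s L] assms(2,3) by (force simp: alive_def[of L X t])
  then show ?thesis using False by (simp add: Z_eq_0_iff)
qed (simp add: Z_eq_None_iff)

text \<open>Being an infimum, T does not determine the state at T itself. By monotonicity of
  absorption, T > t means survival at some later time, and countably many such times suffice, which
  gives measurability.\<close>

lemma absorption_time_gt_iff:
  assumes "0 \<le> t"
  shows "absorption_time L X \<omega> > ereal t \<longleftrightarrow>
    (\<exists>n. Z L X (t + 1 / real (Suc n)) \<omega> \<notin> {None, Some 0})"
proof
  assume a: "absorption_time L X \<omega> > ereal t"
  obtain u where u: "t < u" "ereal u < absorption_time L X \<omega>"
    using ereal_dense2[OF a] by auto
  obtain n where n: "1 / real (Suc n) < u - t"
    using nat_approx_posE[of "u - t"] u by auto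
  have "ereal (t + 1 / real (Suc n)) < ereal u"
    using n by (simp add: less_diff_eq add.commute)
  then have "\<not> absorption_time L X \<omega> \<le> ereal (t + 1 / real (Suc n))"
    using u(2) by (meson less_trans not_le)
  moreover have "absorption_time L X \<omega> \<le> ereal v" if "0 \<le> v" "Z L X v \<omega> \<in> {None, Some 0}" for v
    using that by (auto simp: absorption_time_def T0_def T1_def min_le_iff_disj intro!: Inf_lower imageI)
  ultimately show "\<exists>n. Z L X (t + 1 / real (Suc n)) \<omega> \<notin> {None, Some 0}"
    using assms by (metis add_nonneg_nonneg divide_nonneg_nonneg of_nat_0_le_iff zero_le_one)
next
  assume "\<exists>n. Z L X (t + 1 / real (Suc n)) \<omega> \<notin> {None, Some 0}"
  then obtain n where n: "Z L X (t + 1 / real (Suc n)) \<omega> \<notin> {None, Some 0}" by blast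
  let ?v = "t + 1 / real (Suc n)"
  have "ereal ?v \<le> ereal u" if "0 \<le> u" "Z L X u \<omega> \<in> {None, Some 0}" for u
    using absorbed_mono[OF that(2,1), of ?v] n by (cases "u \<le> ?v") auto
  then have "ereal ?v \<le> absorption_time L X \<omega>"
    by (auto simp: absorption_time_def T0_def T1_def intro!: Inf_greatest)
  moreover have "ereal t < ereal ?v" by simp
  ultimately show "absorption_time L X \<omega> > ereal t" by (rule less_le_trans[rotated])
qed

section \<open>The renewal equation\<close>

lemma Z_cong:
  assumes "\<And>u. L u \<omega> = L' u \<omega>'" "\<And>u. X u \<omega> = X' u \<omega>'"
  shows "Z L X t \<omega> = Z L' X' t \<omega>'"
proof -
  have b: "birth_time L u \<omega> = birth_time L' u \<omega>'" for u by (induction u) (auto simp: assms)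
  have r: "realized X u \<omega> = realized X' u \<omega>'" for u by (induction u) (auto simp: assms)
  show ?thesis by (simp add: Z_def alive_def death_time_def assms b r)
qed

text \<open>Joint measurability in time and labels is needed to integrate over the time of the first
  death.\<close>

lemma measurable_Z:
  assumes L [measurable]: "\<And>u. L u \<in> borel_measurable N"
    and X [measurable]: "\<And>u. X u \<in> measurable N (count_space UNIV)"
  shows "(\<lambda>(t, \<omega>). Z L X t \<omega>) \<in> measurable (borel \<Otimes>\<^sub>M N) (count_space UNIV)"
proof -
  have b [measurable]: "(\<lambda>\<omega>. birth_time L u \<omega>) \<in> borel_measurable N" for u
    by (induction u) auto
  have d [measurable]: "(\<lambda>\<omega>. death_time L u \<omega>) \<in> borel_measurable N" for u
    unfolding death_time_def by measurable
  have r [measurable]: "Measurable.pred N (\<lambda>\<omega>. realized X u \<omega>)" for u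
    by (induction u) auto
  have g [measurable]: "Measurable.pred (borel \<Otimes>\<^sub>M N) (\<lambda>x. graveyard L X (fst x) (snd x))"
    unfolding graveyard_def by measurable
  have a [measurable]: "Measurable.pred (borel \<Otimes>\<^sub>M N) (\<lambda>x. u \<in> alive L X (fst x) (snd x))" for u
    unfolding alive_def mem_Collect_eq by measurable
  \<comment> \<open>Label sets are transported to sets of natural numbers, for which finiteness and
    cardinality are measurable.\<close>
  have bij: "bij_betw to_nat A {i. from_nat i \<in> A \<and> to_nat (from_nat i :: nat list) = i}"
    for A :: "nat list set"
    by (rule bij_betw_byWitness[where f' = from_nat]) auto
  have f [measurable]: "Measurable.pred (borel \<Otimes>\<^sub>M N) (\<lambda>x. finite (alive L X (fst x) (snd x)))"
    by (subst bij_betw_finite[OF bij]) measurable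
  have c [measurable]: "(\<lambda>x. card (alive L X (fst x) (snd x))) \<in> measurable (borel \<Otimes>\<^sub>M N) (count_space UNIV)"
    by (subst bij_betw_same_card[OF bij]) measurable
  have "(\<lambda>x. Z L X (fst x) (snd x)) \<in> measurable (borel \<Otimes>\<^sub>M N) (count_space UNIV)"
    unfolding Z_eq by measurable
  then show ?thesis by (simp add: case_prod_beta')
qed

lemma measurable_Z_time:
  assumes "\<And>u. L u \<in> borel_measurable N" "\<And>u. X u \<in> measurable N (count_space UNIV)"
  shows "(\<lambda>\<omega>. Z L X t \<omega>) \<in> measurable N (count_space UNIV)"
proof -
  note [measurable] = measurable_Z[OF assms]
  have "(\<lambda>\<omega>. (\<lambda>(t, \<omega>). Z L X t \<omega>) (t, \<omega>)) \<in> measurable N (count_space UNIV)"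
    by measurable
  then show ?thesis by simp
qed

text \<open>Offspring numbers are coded as reals so that all the labels take values in one space.\<close>

definition opt_code :: "nat option \<Rightarrow> real" where
  "opt_code z = (case z of None \<Rightarrow> - 1 | Some k \<Rightarrow> real k)"

definition opt_decode :: "real \<Rightarrow> nat option" where
  "opt_decode x = (if x < 0 then None else Some (nat \<lfloor>x\<rfloor>))"

lemma opt_decode_code [simp]: "opt_decode (opt_code z) = z"
  by (auto simp: opt_code_def opt_decode_def split: option.splits)

lemma measurable_opt_decode [measurable]: "opt_decode \<in> measurable borel (count_space UNIV)"
  unfolding opt_decode_def by measurable

text \<open>The canonical labels on the product space: Z becomes one fixed functional of a label
  family, so that equality in law of two families transfers to Z.\<close>

definition L_coord :: "nat list \<Rightarrow> (nat list + nat list \<Rightarrow> real) \<Rightarrow> real" where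
  "L_coord u w = w (Inl u)"

definition X_coord :: "nat list \<Rightarrow> (nat list + nat list \<Rightarrow> real) \<Rightarrow> nat option" where
  "X_coord u w = opt_decode (w (Inr u))"

lemma measurable_L_coord: "Inl u \<in> J \<Longrightarrow> L_coord u \<in> borel_measurable (PiM J (\<lambda>_. borel))"
  unfolding L_coord_def by measurable

lemma measurable_X_coord: "Inr u \<in> J \<Longrightarrow> X_coord u \<in> measurable (PiM J (\<lambda>_. borel)) (count_space UNIV)"
  unfolding X_coord_def by measurable

definition label_shift :: "nat \<Rightarrow> nat list + nat list \<Rightarrow> nat list + nat list" where
  "label_shift i = map_sum (\<lambda>u. u @ [i]) (\<lambda>u. u @ [i])"

lemma label_shift_simps [simp]:
  "label_shift i (Inl u) = Inl (u @ [i])" "label_shift i (Inr u) = Inr (u @ [i])"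
  by (simp_all add: label_shift_def)

lemma inj_label_shift: "inj (label_shift i)"
  unfolding label_shift_def by (intro sum.inj_map injI) auto

context branching_process
begin

section \<open>Independence and self-similarity of the labels\<close>

lemma L_measurable [measurable]: "L u \<in> borel_measurable M"
  using L_distributed[of u] by (auto dest: distributed_measurable)

lemmas [measurable] = X_measurable

definition W :: "nat list + nat list \<Rightarrow> 'w \<Rightarrow> real" where
  "W = case_sum L (\<lambda>u \<omega>. opt_code (X u \<omega>))"

lemma W_simps [simp]: "W (Inl u) \<omega> = L u \<omega>" "W (Inr u) \<omega> = opt_code (X u \<omega>)"
  by (simp_all add: W_def)

lemma W_measurable [measurable]: "W j \<in> borel_measurable M"
proof (cases j)
  case (Inl u)
  then show ?thesis by (simp add: W_def)
next
  case (Inr u)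
  have "(\<lambda>\<omega>. opt_code (X u \<omega>)) \<in> borel_measurable M"
    by measurable
  then show ?thesis by (simp add: W_def Inr)
qed

lemma indep_W: "indep_vars (\<lambda>_. borel) W UNIV"
  unfolding indep_vars_def2
proof
  show "indep_sets (\<lambda>i. {W i -` A \<inter> space M |A. A \<in> sets borel}) UNIV"
  proof (rule indep_sets_mono_sets[OF indep])
    fix i :: "nat list + nat list"
    show "{W i -` A \<inter> space M |A. A \<in> sets borel} \<subseteq>
      (case i of Inl u \<Rightarrow> {L u -` A \<inter> space M |A. A \<in> sets borel}
       | Inr u \<Rightarrow> {X u -` B \<inter> space M |B. B \<in> sets (count_space UNIV)})"
    proof (cases i)
      case (Inr u)
      have "\<exists>B. W i -` A \<inter> space M = X u -` B \<inter> space M" for A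
        by (rule exI[of _ "opt_code -` A"]) (auto simp: Inr)
      then show ?thesis by (auto simp: Inr)
    qed (auto simp: W_def)
  qed
qed auto

lemma distr_W_shift: "distr M borel (W (label_shift i j)) = distr M borel (W j)"
proof (cases j)
  case (Inl u)
  have "distr M borel (L v) = distr M lborel (L v)" for v by (rule distr_cong) auto
  then have "distr M borel (L v) = density lborel (exponential_density 1)" for v
    using L_distributed[of v] by (simp add: distributed_distr_eq_density)
  then show ?thesis by (simp add: Inl label_shift_def W_def)
next
  case (Inr u)
  have "distr M (count_space UNIV) (X v) = distr M (count_space UNIV) (X w)" for v w
  proof (rule measure_eqI_countable[of _ UNIV])
    fix z :: "nat option"
    have e: "emeasure (distr M (count_space UNIV) (X v)) {z} = ennreal (\<P>(\<omega> in M. X v \<omega> = z))" for v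
      by (subst emeasure_distr) (auto simp: emeasure_eq_measure vimage_def intro!: arg_cong[where f = prob])
    show "emeasure (distr M (count_space UNIV) (X v)) {z} = emeasure (distr M (count_space UNIV) (X w)) {z}"
      unfolding e by (cases z) (simp_all add: X_Some X_None)
  qed auto
  then have "distr (distr M (count_space UNIV) (X v)) borel opt_code = distr (distr M (count_space UNIV) (X w)) borel opt_code" for v w
    by metis
  then have "distr M borel (\<lambda>\<omega>. opt_code (X v \<omega>)) = distr M borel (\<lambda>\<omega>. opt_code (X w \<omega>))" for v w
    by (subst (asm) (1 2) distr_distr) (auto simp: o_def)
  then show ?thesis by (simp add: Inr label_shift_def W_def)
qed

text \<open>Injectivity of the shift preserves independence, and the marginals agree, so both
  families have the same product law. This is the self-similarity of the family tree.\<close>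

lemma distr_W_shift_PiM:
  "distr M (PiM UNIV (\<lambda>_. borel)) (\<lambda>\<omega> j. W (label_shift i j) \<omega>) =
   distr M (PiM UNIV (\<lambda>_. borel)) (\<lambda>\<omega> j. W j \<omega>)"
proof -
  have "indep_vars (\<lambda>j. PiM {label_shift i j} (\<lambda>_. borel)) (\<lambda>j \<omega>. restrict (\<lambda>i. W i \<omega>) {label_shift i j}) UNIV"
    by (rule indep_vars_restrict[OF indep_W])
       (use inj_label_shift[of i] in \<open>auto simp: disjoint_family_on_def inj_on_def\<close>)
  then have "indep_vars (\<lambda>_. borel) (\<lambda>j \<omega>. (\<lambda>w. w (label_shift i j)) (restrict (\<lambda>i. W i \<omega>) {label_shift i j})) UNIV"
    by (rule indep_vars_compose2) measurable
  then have "indep_vars (\<lambda>_. borel) (\<lambda>j. W (label_shift i j)) UNIV"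
    by simp
  then show ?thesis
    using indep_W indep_vars_iff_distr_eq_PiM[where I = UNIV and M' = "\<lambda>_. borel" and X = W]
      indep_vars_iff_distr_eq_PiM[where I = UNIV and M' = "\<lambda>_. borel" and X = "\<lambda>j. W (label_shift i j)"]
    by (simp add: distr_W_shift restrict_def)
qed

abbreviation "L_sub i \<equiv> \<lambda>u. L (u @ [i])"
abbreviation "X_sub i \<equiv> \<lambda>u. X (u @ [i])"

lemma nn_integral_Z_subtree:
  fixes f :: "enat option \<Rightarrow> ennreal"
  shows "(\<integral>\<^sup>+\<omega>. f (Z (L_sub i) (X_sub i) t \<omega>) \<partial>M) = (\<integral>\<^sup>+\<omega>. f (Z L X t \<omega>) \<partial>M)"
proof -
  let ?Pi = "PiM UNIV (\<lambda>_. borel) :: (nat list + nat list \<Rightarrow> real) measure"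
  have m [measurable]: "(\<lambda>w. Z L_coord X_coord t w) \<in> measurable ?Pi (count_space UNIV)"
    by (rule measurable_Z_time) (auto intro: measurable_L_coord measurable_X_coord)
  have W [measurable]: "(\<lambda>\<omega> j. W (g j) \<omega>) \<in> measurable M ?Pi" for g
    by (rule measurable_PiM_single') auto
  have "(\<integral>\<^sup>+\<omega>. f (Z (L_sub i) (X_sub i) t \<omega>) \<partial>M) =
      (\<integral>\<^sup>+\<omega>. f (Z L_coord X_coord t (\<lambda>j. W (label_shift i j) \<omega>)) \<partial>M)"
    by (intro nn_integral_cong arg_cong[where f = f] Z_cong)
       (auto simp: L_coord_def X_coord_def label_shift_def)
  also have "\<dots> = (\<integral>\<^sup>+w. f (Z L_coord X_coord t w) \<partial>distr M ?Pi (\<lambda>\<omega> j. W (label_shift i j) \<omega>))"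
    by (subst nn_integral_distr) auto
  also have "\<dots> = (\<integral>\<^sup>+w. f (Z L_coord X_coord t w) \<partial>distr M ?Pi (\<lambda>\<omega> j. W j \<omega>))"
    by (simp add: distr_W_shift_PiM)
  also have "\<dots> = (\<integral>\<^sup>+\<omega>. f (Z L_coord X_coord t (\<lambda>j. W j \<omega>)) \<partial>M)"
    using W[of "\<lambda>j. j"] by (subst nn_integral_distr) auto
  also have "\<dots> = (\<integral>\<^sup>+\<omega>. f (Z L X t \<omega>) \<partial>M)"
    by (intro nn_integral_cong arg_cong[where f = f] Z_cong) (auto simp: L_coord_def X_coord_def)
  finally show ?thesis .
qed

lemma measurable_Z_sub [measurable]:
  "(\<lambda>\<omega>. Z (L_sub i) (X_sub i) t \<omega>) \<in> measurable M (count_space UNIV)"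
  "(\<lambda>\<omega>. Z L X t \<omega>) \<in> measurable M (count_space UNIV)"
  by (rule measurable_Z_time; measurable)+

text \<open>The root's offspring number and the subtrees are functions of disjoint blocks of labels,
  hence independent, and each subtree has the law of the whole tree. The root's life length enters
  none of the blocks.\<close>

lemma nn_integral_branch:
  fixes f :: "enat option \<Rightarrow> ennreal"
  shows "(\<integral>\<^sup>+\<omega>. indicator {\<omega>. X [] \<omega> = Some k} \<omega> * (\<Prod>i<k. f (Z (L_sub i) (X_sub i) t \<omega>)) \<partial>M)
    = p k * (\<integral>\<^sup>+\<omega>. f (Z L X t \<omega>) \<partial>M) ^ k"
proof -
  let ?I = "insert None (Some ` {..<k})"
  define B where "B j = (case j of None \<Rightarrow> {Inr []} | Some i \<Rightarrow> range (label_shift i))" for j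
  define Y where "Y j = (case j of
      None \<Rightarrow> (\<lambda>w. indicator {w. X_coord [] w = Some k} w)
    | Some i \<Rightarrow> (\<lambda>w. f (Z (\<lambda>u. L_coord (u @ [i])) (\<lambda>u. X_coord (u @ [i])) t w)))" for j
  have Y: "Y j \<in> borel_measurable (PiM (B j) (\<lambda>_. borel))" for j
  proof (cases j)
    case None
    have [measurable]: "X_coord [] \<in> measurable (PiM {Inr []} (\<lambda>_. borel)) (count_space UNIV)"
      by (rule measurable_X_coord) auto
    show ?thesis unfolding None Y_def B_def option.case by measurable
  next
    case (Some i)
    have "label_shift i l \<in> B j" for l by (simp add: Some B_def)
    note m = this[of "Inl _"] this[of "Inr _"]
    have [measurable]: "(\<lambda>w. Z (\<lambda>u. L_coord (u @ [i])) (\<lambda>u. X_coord (u @ [i])) t w)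
        \<in> measurable (PiM (B j) (\<lambda>_. borel)) (count_space UNIV)"
      by (rule measurable_Z_time; rule measurable_L_coord measurable_X_coord) (use m in simp_all)
    have "(\<lambda>w. f (Z (\<lambda>u. L_coord (u @ [i])) (\<lambda>u. X_coord (u @ [i])) t w))
        \<in> borel_measurable (PiM (B j) (\<lambda>_. borel))"
      by measurable
    then show ?thesis by (simp add: Y_def Some)
  qed
  have "indep_vars (\<lambda>j. PiM (B j) (\<lambda>_. borel)) (\<lambda>j \<omega>. restrict (\<lambda>i. W i \<omega>) (B j)) ?I"
  proof (rule indep_vars_restrict[OF indep_W])
    show "disjoint_family_on B ?I"
      by (auto simp: disjoint_family_on_def B_def label_shift_def map_sum_def split: sum.splits)
  qed auto
  then have "indep_vars (\<lambda>_. borel) (\<lambda>j \<omega>. Y j (restrict (\<lambda>i. W i \<omega>) (B j))) ?I"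
    by (rule indep_vars_compose2) (rule Y)
  then have "(\<integral>\<^sup>+\<omega>. (\<Prod>j\<in>?I. Y j (restrict (\<lambda>i. W i \<omega>) (B j))) \<partial>M) =
      (\<Prod>j\<in>?I. \<integral>\<^sup>+\<omega>. Y j (restrict (\<lambda>i. W i \<omega>) (B j)) \<partial>M)"
    by (intro indep_vars_nn_integral) auto
  moreover have "Y None (restrict (\<lambda>i. W i \<omega>) (B None)) = indicator {\<omega>. X [] \<omega> = Some k} \<omega>" for \<omega>
    by (auto simp: Y_def B_def X_coord_def indicator_def)
  moreover have "Y (Some i) (restrict (\<lambda>i. W i \<omega>) (B (Some i))) = f (Z (L_sub i) (X_sub i) t \<omega>)" for i \<omega>
  proof -
    have "label_shift i j \<in> B (Some i)" for j by (auto simp: B_def)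
    from this[of "Inl _"] this[of "Inr _"] show ?thesis
      unfolding Y_def option.case
      by (intro arg_cong[where f = f] Z_cong) (simp_all add: L_coord_def X_coord_def label_shift_def)
  qed
  moreover have "(\<integral>\<^sup>+\<omega>. indicator {\<omega>. X [] \<omega> = Some k} \<omega> \<partial>M) = ennreal (p k)"
  proof -
    have "(\<integral>\<^sup>+\<omega>. indicator {\<omega>. X [] \<omega> = Some k} \<omega> \<partial>M) = (\<integral>\<^sup>+\<omega>. indicator {\<omega>\<in>space M. X [] \<omega> = Some k} \<omega> \<partial>M)"
      by (intro nn_integral_cong) (auto simp: indicator_def)
    also have "\<dots> = ennreal (p k)"
      by (subst nn_integral_indicator) (auto simp: emeasure_eq_measure X_Some)
    finally show ?thesis .
  qed
  ultimately show ?thesis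
    by (simp add: prod.reindex nn_integral_Z_subtree)
qed

section \<open>The generating function as a function of time\<close>

definition G :: "real \<Rightarrow> real \<Rightarrow> real" where
  "G s t = expectation (\<lambda>\<omega>. pgf_weight s (Z L X t \<omega>))"

lemma p_sum_1: "summable (\<lambda>k. p k * 1 ^ k)"
  using p_summable by simp

lemma summable_p_unit: "0 \<le> x \<Longrightarrow> x \<le> 1 \<Longrightarrow> summable (\<lambda>k. p k * x ^ k)"
  by (rule summable_gf_mono[OF p_nonneg p_sum_1]) auto

lemma gf_p_unit: "0 \<le> x \<Longrightarrow> x \<le> 1 \<Longrightarrow> gf p x \<in> {0..1}"
  using gf_mono[OF p_nonneg p_sum_1, of x] gf_nonneg[OF p_nonneg summable_p_unit, of x] p_sum_le_1
  by auto

lemma suminf_gf_p: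
  assumes "0 \<le> x" "x \<le> 1"
  shows "(\<Sum>k. ennreal (p k) * ennreal x ^ k) = ennreal (gf p x)"
proof -
  have "ennreal (p k) * ennreal x ^ k = ennreal (p k * x ^ k)" for k
    using assms p_nonneg by (simp add: ennreal_mult ennreal_power)
  then show ?thesis
    unfolding gf_def using summable_p_unit[OF assms] assms p_nonneg
    by (simp add: suminf_ennreal2)
qed

lemma G_bounds: "0 \<le> s \<Longrightarrow> s \<le> 1 \<Longrightarrow> G s t \<in> {0..1}"
  unfolding G_def using pgf_weight_bounds[of s]
  by (auto intro!: integral_nonneg_AE integral_le_const integrable_const_bound[where B = 1] AE_I2)

lemma nn_integral_pgf_weight:
  assumes "0 \<le> s" "s \<le> 1"
  shows "(\<integral>\<^sup>+\<omega>. ennreal (pgf_weight s (Z L X t \<omega>)) \<partial>M) = ennreal (G s t)"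
  unfolding G_def using pgf_weight_bounds[of s] assms
  by (intro nn_integral_eq_integral)
     (auto intro!: integrable_const_bound[where B = 1] AE_I2)

lemma G_measurable [measurable]: "G s \<in> borel_measurable borel"
proof -
  have [measurable]: "(\<lambda>(t, \<omega>). Z L X t \<omega>) \<in> measurable (borel \<Otimes>\<^sub>M M) (count_space UNIV)"
    by (rule measurable_Z) auto
  have "(\<lambda>(t, \<omega>). pgf_weight s (case (t, \<omega>) of (t, \<omega>) \<Rightarrow> Z L X t \<omega>)) \<in> borel_measurable (borel \<Otimes>\<^sub>M M)"
    unfolding case_prod_beta' by measurable
  then show ?thesis
    unfolding G_def [abs_def] by (intro borel_measurable_lebesgue_integral) (simp add: case_prod_beta')
qed

lemma AE_L_pos: "AE \<omega> in M. \<forall>u. L u \<omega> > 0"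
  unfolding AE_all_countable
proof
  fix u
  have "\<P>(\<omega> in M. L u \<omega> \<le> 0) = 1 - exp (- 0 * 1)"
    by (rule exponential_distributedD_le[OF L_distributed]) auto
  then have "emeasure M {\<omega>\<in>space M. L u \<omega> \<le> 0} = 0"
    by (simp add: emeasure_eq_measure)
  then show "AE \<omega> in M. L u \<omega> > 0"
    by (intro AE_I[of _ _ "{\<omega>\<in>space M. L u \<omega> \<le> 0}"]) (auto simp: not_less)
qed

text \<open>The root's life length is independent of all other labels, so the expectation can be
  taken with the time x of the first death held fixed; the inner expectation is s if x > t and f(G s
  (t - x)) otherwise.\<close>

lemma G_renewal:
  assumes s: "0 \<le> s" "s \<le> 1" and t: "0 \<le> t"
  shows "ennreal (G s t) = ennreal (s * exp (- t)) +
    (\<integral>\<^sup>+u. ennreal (indicator {0..t} u * (exp (- u) * gf p (G s (t - u)))) \<partial>lborel)"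
proof -
  \<comment> \<open>Only the root's life length is split off; its offspring number stays among the
    remaining labels.\<close>
  let ?J = "- {Inl []} :: (nat list + nat list) set"
  let ?Pi = "PiM ?J (\<lambda>_. borel :: real measure)"
  define \<phi> where "\<phi> z = ennreal (pgf_weight s z)" for z
  define S where "S \<tau> w = (\<Sum>k. indicator {w. X_coord [] w = Some k} w *
    (\<Prod>i<k. \<phi> (Z (\<lambda>u. L_coord (u @ [i])) (\<lambda>u. X_coord (u @ [i])) \<tau> w)))" for \<tau> w
  define h where "h x w = (if t < x then ennreal s else S (t - x) w)" for x w
  define g where "g x = (if t < x then ennreal s else ennreal (gf p (G s (t - x))))" for x
  let ?Pr = "PiM {Inl []} (\<lambda>_. borel :: real measure) :: (nat list + nat list \<Rightarrow> real) measure"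
  define root where "root \<omega> = restrict (\<lambda>j. W j \<omega>) {Inl []}" for \<omega>
  have [measurable]: "root \<in> measurable M ?Pr"
    unfolding root_def by measurable
  define rest where "rest \<omega> = restrict (\<lambda>j. W j \<omega>) ?J" for \<omega>
  have [measurable]: "rest \<in> measurable M ?Pi"
    unfolding rest_def by measurable
  have Z_rest: "Z (\<lambda>u. L_coord (u @ [i])) (\<lambda>u. X_coord (u @ [i])) \<tau> (rest \<omega>) =
      Z (L_sub i) (X_sub i) \<tau> \<omega>" for i \<tau> \<omega>
    by (intro Z_cong) (auto simp: L_coord_def X_coord_def rest_def)
  have X_rest: "X_coord [] (rest \<omega>) = X [] \<omega>" for \<omega>
    by (simp add: X_coord_def rest_def)
  have [measurable]: "X_coord [] \<in> measurable ?Pi (count_space UNIV)"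
    by (rule measurable_X_coord) auto
  have Zm: "(\<lambda>(\<tau>, w). Z (\<lambda>u. L_coord (u @ [i])) (\<lambda>u. X_coord (u @ [i])) \<tau> w)
      \<in> measurable (borel \<Otimes>\<^sub>M ?Pi) (count_space UNIV)" for i
    by (rule measurable_Z; rule measurable_L_coord measurable_X_coord) auto
  have [measurable]: "(\<lambda>x. Z (\<lambda>u. L_coord (u @ [i])) (\<lambda>u. X_coord (u @ [i])) (t - fst x) (snd x))
      \<in> measurable (borel \<Otimes>\<^sub>M ?Pi) (count_space UNIV)" for i
    using measurable_compose[OF _ Zm, of "\<lambda>x. (t - fst x, snd x)" "borel \<Otimes>\<^sub>M ?Pi" i] by simp
  have Sm [measurable]: "(\<lambda>x. S (t - fst x) (snd x)) \<in> borel_measurable (borel \<Otimes>\<^sub>M ?Pi)"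
    unfolding S_def \<phi>_def by measurable
  have hm: "(\<lambda>x. h (fst x) (snd x)) \<in> borel_measurable (borel \<Otimes>\<^sub>M ?Pi)"
    unfolding h_def by measurable
  have [measurable]: "(\<lambda>x. h (fst x (Inl [])) (snd x)) \<in> borel_measurable (?Pr \<Otimes>\<^sub>M ?Pi)"
    using measurable_compose[OF _ hm, of "\<lambda>x. (fst x (Inl []), snd x)" "?Pr \<Otimes>\<^sub>M ?Pi"] by simp
  have "(\<lambda>x. \<Sum>k. p k * G s (t - x) ^ k) \<in> borel_measurable borel" by measurable
  then have [measurable]: "(\<lambda>x. gf p (G s (t - x))) \<in> borel_measurable borel" by (simp add: gf_def)
  have [measurable]: "g \<in> borel_measurable borel"
    unfolding g_def by measurable
  have inner: "(\<integral>\<^sup>+w. h x w \<partial>distr M ?Pi rest) = g x" for x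
  proof -
    have "(\<integral>\<^sup>+w. h x w \<partial>distr M ?Pi rest) = (\<integral>\<^sup>+\<omega>. h x (rest \<omega>) \<partial>M)"
      using measurable_compose[OF measurable_Pair1' hm, of x] by (subst nn_integral_distr) auto
    also have "\<dots> = g x"
    proof (cases "t < x")
      case True
      then show ?thesis by (simp add: h_def g_def emeasure_space_1)
    next
      case False
      have "(\<integral>\<^sup>+\<omega>. S (t - x) (rest \<omega>) \<partial>M) = (\<Sum>k. \<integral>\<^sup>+\<omega>. indicator {\<omega>. X [] \<omega> = Some k} \<omega> *
          (\<Prod>i<k. \<phi> (Z (L_sub i) (X_sub i) (t - x) \<omega>)) \<partial>M)"
        unfolding S_def Z_rest
        by (subst nn_integral_suminf [symmetric])
           (auto simp: X_rest \<phi>_def indicator_def intro!: nn_integral_cong suminf_cong)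
      also have "\<dots> = (\<Sum>k. ennreal (p k) * ennreal (G s (t - x)) ^ k)"
        using nn_integral_branch[of _ \<phi> "t - x"] nn_integral_pgf_weight[OF s] by (simp add: \<phi>_def)
      also have "\<dots> = ennreal (gf p (G s (t - x)))"
        by (rule suminf_gf_p) (use G_bounds[OF s] in auto)
      finally show ?thesis using False by (simp add: h_def g_def)
    qed
    finally show ?thesis .
  qed
  \<comment> \<open>The two sides can differ only where some life length is nonpositive.\<close>
  have "AE \<omega> in M. \<phi> (Z L X t \<omega>) = h (L [] \<omega>) (rest \<omega>)"
    using AE_L_pos
  proof eventually_elim
    case (elim \<omega>)
    show ?case
    proof (cases "t < L [] \<omega>")
      case True
      then show ?thesis
        using Z_before_root_death[of L \<omega> t X] elim t
        by (simp add: h_def \<phi>_def pgf_weight_def one_enat_def)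
    next
      case False
      then have le: "L [] \<omega> \<le> t" by simp
      show ?thesis
      proof (cases "X [] \<omega>")
        case None
        then have "Z L X t \<omega> = None"
          using graveyard_after_root_death[of L \<omega> t X] le by (simp add: Z_eq_None_iff)
        then show ?thesis
          using False None by (simp add: h_def S_def X_rest \<phi>_def pgf_weight_def)
      next
        case (Some k)
        have "S (t - L [] \<omega>) (rest \<omega>) = (\<Sum>k'\<in>{k}. indicator {w. X_coord [] w = Some k'} (rest \<omega>) *
            (\<Prod>i<k'. \<phi> (Z (L_sub i) (X_sub i) (t - L [] \<omega>) \<omega>)))"
          unfolding S_def Z_rest by (rule suminf_finite) (auto simp: X_rest Some indicator_def)
        also have "\<dots> = \<phi> (Z L X t \<omega>)"
          using pgf_weight_bounds[OF s]
          by (simp add: X_rest Some \<phi>_def pgf_weight_branch[of L \<omega> t X k s, OF le Some] prod_ennreal)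
        finally show ?thesis using False by (simp add: h_def)
      qed
    qed
  qed
  then have "ennreal (G s t) = (\<integral>\<^sup>+\<omega>. h (L [] \<omega>) (rest \<omega>) \<partial>M)"
    unfolding nn_integral_pgf_weight[OF s, symmetric] \<phi>_def by (rule nn_integral_cong_AE)
  also have "\<dots> = (\<integral>\<^sup>+x. h (fst x (Inl [])) (snd x) \<partial>distr M (?Pr \<Otimes>\<^sub>M ?Pi) (\<lambda>\<omega>. (root \<omega>, rest \<omega>)))"
    by (subst nn_integral_distr) (auto simp: root_def)
  also have "distr M (?Pr \<Otimes>\<^sub>M ?Pi) (\<lambda>\<omega>. (root \<omega>, rest \<omega>)) = distr M ?Pr root \<Otimes>\<^sub>M distr M ?Pi rest"
  proof -
    have "indep_var ?Pr root ?Pi rest"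
      unfolding rest_def root_def by (rule indep_var_restrict[OF indep_W]) auto
    then show ?thesis by (simp add: indep_var_distribution_eq)
  qed
  also have "(\<integral>\<^sup>+x. h (fst x (Inl [])) (snd x) \<partial>(distr M ?Pr root \<Otimes>\<^sub>M distr M ?Pi rest)) =
      (\<integral>\<^sup>+x. \<integral>\<^sup>+w. h (x (Inl [])) w \<partial>distr M ?Pi rest \<partial>distr M ?Pr root)"
  proof -
    interpret R: prob_space "distr M ?Pi rest" by (rule prob_space_distr) measurable
    show ?thesis
      by (subst R.nn_integral_fst [symmetric]) (simp_all cong: measurable_cong_sets)
  qed
  also have "\<dots> = (\<integral>\<^sup>+x. g (x (Inl [])) \<partial>distr M ?Pr root)"
    by (intro nn_integral_cong inner)
  also have "\<dots> = (\<integral>\<^sup>+\<omega>. g (L [] \<omega>) \<partial>M)"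
    by (subst nn_integral_distr) (auto simp: root_def)
  also have "\<dots> = (\<integral>\<^sup>+x. g x \<partial>distr M borel (L []))"
    by (subst nn_integral_distr) auto
  also have "\<dots> = (\<integral>\<^sup>+x. ennreal s * indicator {t<..} x +
      ennreal (indicator {..t} x * gf p (G s (t - x))) \<partial>distr M borel (L []))"
    by (intro nn_integral_cong) (auto simp: indicator_def g_def)
  also have "\<dots> = ennreal s * emeasure (distr M borel (L [])) {t<..} +
      (\<integral>\<^sup>+x. ennreal (indicator {..t} x * gf p (G s (t - x))) \<partial>distr M borel (L []))"
    by (subst nn_integral_add) (auto simp: nn_integral_cmult)
  also have "emeasure (distr M borel (L [])) {t<..} = ennreal (exp (- t))"
  proof -
    have "emeasure (distr M borel (L [])) {t<..} = ennreal (\<P>(\<omega> in M. t < L [] \<omega>))"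
      by (subst emeasure_distr) (auto simp: emeasure_eq_measure vimage_def intro!: arg_cong[where f = prob])
    also have "\<P>(\<omega> in M. t < L [] \<omega>) = exp (- t * 1)"
      by (rule exponential_distributedD_gt[OF L_distributed]) (use t in auto)
    finally show ?thesis by simp
  qed
  also have "distr M borel (L []) = density lborel (exponential_density 1)"
  proof -
    have "distr M borel (L []) = distr M lborel (L [])" by (rule distr_cong) auto
    then show ?thesis using L_distributed[of "[]"] by (simp add: distributed_distr_eq_density)
  qed
  also have "(\<integral>\<^sup>+x. ennreal (indicator {..t} x * gf p (G s (t - x))) \<partial>density lborel (exponential_density 1)) =
      (\<integral>\<^sup>+u. ennreal (indicator {0..t} u * (exp (- u) * gf p (G s (t - u)))) \<partial>lborel)"
    by (subst nn_integral_density)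
       (auto intro!: nn_integral_cong simp: indicator_def exponential_density_def simp flip: ennreal_mult')
  finally show ?thesis using s by (simp add: ennreal_mult)
qed

lemma G_0: "0 \<le> s \<Longrightarrow> s \<le> 1 \<Longrightarrow> G s 0 = s"
proof -
  assume s: "0 \<le> s" "s \<le> 1"
  have "(\<integral>\<^sup>+u. ennreal (indicator {0..0} u * (exp (- u) * gf p (G s (0 - u)))) \<partial>lborel) =
      (\<integral>\<^sup>+u. 0 \<partial>(lborel :: real measure))"
    by (rule nn_integral_cong_AE)
       (use AE_lborel_singleton[of "0::real"] in eventually_elim, auto simp: indicator_def)
  then have "ennreal (G s 0) = ennreal s" using G_renewal[OF s, of 0] by simp
  then show ?thesis using s G_bounds[OF s] by simp
qed

text \<open>The substitution v = t - u together with the factor exp t removes t from the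
  integrand.\<close>

lemma G_integral:
  assumes s: "0 \<le> s" "s \<le> 1" and t: "0 \<le> t"
  shows "((\<lambda>v. exp v * gf p (G s v)) has_integral (exp t * G s t - s)) {0..t}"
proof -
  have "(\<lambda>x. \<Sum>k. p k * G s x ^ k) \<in> borel_measurable borel" by measurable
  then have [measurable]: "(\<lambda>x. gf p (G s x)) \<in> borel_measurable borel" by (simp add: gf_def)
  let ?f = "\<lambda>v. indicator {0..t} v * (exp v * gf p (G s v))"
  let ?I = "\<integral>\<^sup>+v. ennreal (?f v) \<partial>lborel"
  have nn: "gf p (G s v) \<ge> 0" for v
    using gf_p_unit[of "G s v"] G_bounds[OF s, of v] by auto
  have "(\<integral>\<^sup>+u. ennreal (indicator {0..t} u * (exp (- u) * gf p (G s (t - u)))) \<partial>lborel) =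
      (\<integral>\<^sup>+v. ennreal (indicator {0..t} (t - v) * (exp (- (t - v)) * gf p (G s v))) \<partial>lborel)"
    by (subst nn_integral_real_affine[where c = "- 1" and t = t]) auto
  also have "\<dots> = (\<integral>\<^sup>+v. ennreal (exp (- t)) * ennreal (?f v) \<partial>lborel)"
    by (intro nn_integral_cong)
       (auto simp: indicator_def exp_diff exp_minus field_simps simp flip: ennreal_mult')
  also have "\<dots> = ennreal (exp (- t)) * ?I"
    by (rule nn_integral_cmult) measurable
  finally have e: "ennreal (G s t) = ennreal (s * exp (- t)) + ennreal (exp (- t)) * ?I"
    using G_renewal[OF s t] by simp
  \<comment> \<open>The equation bounds the integral, since its left side is finite.\<close>
  have "?I \<noteq> \<infinity>"
  proof
    assume "?I = \<infinity>"
    then have "ennreal (G s t) = \<infinity>" unfolding e by (simp add: ennreal_mult_top)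
    then show False by simp
  qed
  then obtain y where y: "?I = ennreal y" "y \<ge> 0"
    by (metis ennreal_cases infinity_ennreal_def)
  have "G s t = s * exp (- t) + exp (- t) * y"
    using e s y G_bounds[OF s, of t]
    by (simp add: y flip: ennreal_mult ennreal_plus)
  then have y': "y = exp t * G s t - s"
    by (simp add: exp_minus field_simps)
  have "(?f has_integral y) UNIV"
    by (rule nn_integral_has_integral[OF _ _ y(1,2)]) (use nn in auto)
  moreover have "?f = (\<lambda>v. if v \<in> {0..t} then exp v * gf p (G s v) else 0)"
    by (auto simp: indicator_def)
  ultimately show ?thesis
    unfolding y' by (simp only: has_integral_restrict_UNIV)
qed

text \<open>A bootstrap: the integral equation first gives continuity of G, hence of the integrand,
  and then differentiability by the fundamental theorem.\<close>

lemma G_has_derivative: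
  assumes s: "0 \<le> s" "s \<le> 1" and t: "0 \<le> t"
  shows "(G s has_real_derivative (gf p (G s t) - G s t)) (at t within {0..})"
proof -
  define b where "b = t + 1"
  let ?g = "\<lambda>v. exp v * gf p (G s v)"
  have G: "G s u = exp (- u) * (s + integral {0..u} ?g)" if "u \<ge> 0" for u
    using G_integral[OF s that] by (simp add: integral_unique exp_minus)
  have eq: "exp (- u) * (s + integral {0..u} ?g) = G s u" if "u \<in> {0..b}" for u
    by (rule G [symmetric]) (use that in simp)
  have int: "?g integrable_on {0..b}"
    using G_integral[OF s, of b] t by (auto simp: b_def)
  have "continuous_on {0..b} (\<lambda>u. exp (- u) * (s + integral {0..u} ?g))"
    by (intro continuous_intros indefinite_integral_continuous_1 int)
  then have "continuous_on {0..b} (G s)"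
    by (rule continuous_on_eq) (rule eq)
  then have "continuous_on {0..b} ?g"
    by (intro continuous_intros continuous_on_compose2[OF gf_continuous_on[OF p_nonneg p_sum_1]])
       (use G_bounds[OF s] in auto)
  then have "((\<lambda>u. integral {0..u} ?g) has_vector_derivative ?g t) (at t within {0..b})"
    by (rule integral_has_vector_derivative) (use t in \<open>auto simp: b_def\<close>)
  then have d: "((\<lambda>u. integral {0..u} ?g) has_real_derivative ?g t) (at t within {0..b})"
    by (simp add: has_real_derivative_iff_has_vector_derivative)
  have "((\<lambda>u. exp (- u) * (s + integral {0..u} ?g)) has_real_derivative
      exp (- t) * ?g t - exp (- t) * (s + integral {0..t} ?g)) (at t within {0..b})"
    by (auto intro!: derivative_eq_intros d)
  moreover have "exp (- t) * ?g t - exp (- t) * (s + integral {0..t} ?g) = gf p (G s t) - G s t"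
    unfolding G[OF t, symmetric] by (simp add: exp_minus)
  ultimately have "((\<lambda>u. exp (- u) * (s + integral {0..u} ?g)) has_real_derivative
      gf p (G s t) - G s t) (at t within {0..b})" by simp
  then have "(G s has_real_derivative (gf p (G s t) - G s t)) (at t within {0..b})"
    by (rule has_field_derivative_transform_within[OF _ zero_less_one])
       (use t in \<open>simp add: b_def\<close>, rule eq)
  moreover have "at t within {0..b} = at t within {0..}"
    by (rule at_within_nhd[of t "{..<b}"]) (use t in \<open>auto simp: b_def\<close>)
  ultimately show ?thesis by simp
qed

lemma G_continuous_on: "0 \<le> s \<Longrightarrow> s \<le> 1 \<Longrightarrow> continuous_on {0..} (G s)"
  unfolding continuous_on_eq_continuous_within using DERIV_continuous[OF G_has_derivative] by simp

lemma G_1_eq: "G 1 t = \<P>(\<omega> in M. Z L X t \<omega> \<noteq> None)"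
proof -
  have "G 1 t = expectation (\<lambda>\<omega>. indicator {\<omega>\<in>space M. Z L X t \<omega> \<noteq> None} \<omega>)"
    unfolding G_def
    by (intro Bochner_Integration.integral_cong)
       (auto simp: pgf_weight_def indicator_def split: option.splits enat.splits)
  then show ?thesis by simp
qed

text \<open>For s < 1 the state \<infinity> has weight 0, so only finite populations
  contribute.\<close>

lemma G_sums:
  assumes "0 \<le> s" "s < 1"
  shows "(\<lambda>k. \<P>(\<omega> in M. Z L X t \<omega> = Some (enat k)) * s ^ k) sums G s t"
proof -
  let ?P = "\<lambda>k. \<P>(\<omega> in M. Z L X t \<omega> = Some (enat k)) * s ^ k"
  have "ennreal (pgf_weight s (Z L X t \<omega>)) =
      (\<Sum>k. indicator {\<omega>\<in>space M. Z L X t \<omega> = Some (enat k)} \<omega> * ennreal (s ^ k))"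
    if "\<omega> \<in> space M" for \<omega>
  proof (cases "\<exists>k. Z L X t \<omega> = Some (enat k)")
    case True
    then obtain k where k: "Z L X t \<omega> = Some (enat k)" by blast
    then show ?thesis using that
      by (subst suminf_finite[of "{k}"]) (auto simp: pgf_weight_def)
  next
    case False
    then have "Z L X t \<omega> = None \<or> Z L X t \<omega> = Some \<infinity>"
      by (metis not_enat_eq option.exhaust)
    then show ?thesis using False assms by (auto simp: pgf_weight_def)
  qed
  then have "ennreal (G s t) = (\<integral>\<^sup>+\<omega>. (\<Sum>k. indicator {\<omega>\<in>space M. Z L X t \<omega> = Some (enat k)} \<omega> * ennreal (s ^ k)) \<partial>M)"
    using assms by (subst nn_integral_pgf_weight [symmetric]) (auto intro!: nn_integral_cong)
  also have "\<dots> = (\<Sum>k. ennreal (?P k))"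
    using assms by (subst nn_integral_suminf)
       (auto simp: nn_integral_multc emeasure_eq_measure ennreal_mult intro!: suminf_cong)
  finally have e: "(\<Sum>k. ennreal (?P k)) = ennreal (G s t)" ..
  have "(\<lambda>k. ennreal (?P k)) sums ennreal (G s t)"
    unfolding e[symmetric] by (rule summable_sums) auto
  then show ?thesis
    using assms G_bounds[of s t] by (subst (asm) sums_ennreal) auto
qed

lemma G_0_eq: "G 0 t = \<P>(\<omega> in M. Z L X t \<omega> = Some 0)"
  using sums_unique2[OF G_sums[of 0 t] powser_sums_zero] by (simp add: zero_enat_def)

text \<open>Explosion counts as survival, in accordance with the weight of \<infinity> at s =
  1.\<close>

definition survival :: "real \<Rightarrow> real" where
  "survival t = \<P>(\<omega> in M. Z L X t \<omega> \<notin> {None, Some 0})"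

lemma survival_eq: "survival t = G 1 t - G 0 t"
proof -
  have "prob ({\<omega>\<in>space M. Z L X t \<omega> \<noteq> None} - {\<omega>\<in>space M. Z L X t \<omega> = Some 0}) =
      prob {\<omega>\<in>space M. Z L X t \<omega> \<noteq> None} - prob {\<omega>\<in>space M. Z L X t \<omega> = Some 0}"
    by (rule finite_measure_Diff) auto
  moreover have "{\<omega>\<in>space M. Z L X t \<omega> \<noteq> None} - {\<omega>\<in>space M. Z L X t \<omega> = Some 0} =
      {\<omega>\<in>space M. Z L X t \<omega> \<notin> {None, Some 0}}" by auto
  ultimately show ?thesis by (simp add: survival_def G_1_eq G_0_eq)
qed

section \<open>From survival at fixed times to the absorption time\<close>

lemma absorption_event:
  assumes "0 \<le> t"
  shows "{\<omega>\<in>space M. absorption_time L X \<omega> > ereal t} =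
    (\<Union>n. {\<omega>\<in>space M. Z L X (t + 1 / real (Suc n)) \<omega> \<notin> {None, Some 0}})"
  using absorption_time_gt_iff[OF assms, of L X] by auto

lemma absorption_event_measurable [measurable]:
  assumes "0 \<le> t"
  shows "{\<omega>\<in>space M. absorption_time L X \<omega> > ereal t} \<in> events"
  unfolding absorption_event[OF assms] by measurable

lemma absorption_event_subset:
  assumes "0 \<le> t"
  shows "{\<omega>\<in>space M. absorption_time L X \<omega> > ereal t} \<subseteq> {\<omega>\<in>space M. Z L X t \<omega> \<notin> {None, Some 0}}"
proof
  fix \<omega> assume "\<omega> \<in> {\<omega>\<in>space M. absorption_time L X \<omega> > ereal t}"
  then obtain n where "\<omega> \<in> space M" "Z L X (t + 1 / real (Suc n)) \<omega> \<notin> {None, Some 0}"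
    unfolding absorption_event[OF assms] by blast
  moreover have "t \<le> t + 1 / real (Suc n)" by simp
  ultimately have "Z L X t \<omega> \<notin> {None, Some 0}"
    using absorbed_mono[of L X t \<omega>, OF _ assms] by blast
  then show "\<omega> \<in> {\<omega>\<in>space M. Z L X t \<omega> \<notin> {None, Some 0}}"
    using \<open>\<omega> \<in> space M\<close> by blast
qed

text \<open>
  The event \<open>T > t\<close> lies between survival up to \<open>t + 1 / n\<close> and survival up to \<open>t\<close>; the gap
  is null because the survival probability is continuous in \<open>t\<close>.
\<close>

lemma prob_absorption:
  assumes t: "0 \<le> t"
  shows "\<P>(\<omega> in M. absorption_time L X \<omega> > ereal t) = survival t"
proof (rule antisym)
  show "\<P>(\<omega> in M. absorption_time L X \<omega> > ereal t) \<le> survival t"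
    unfolding survival_def by (rule finite_measure_mono[OF absorption_event_subset[OF t]]) measurable
  have "survival (t + 1 / real (Suc n)) \<le> \<P>(\<omega> in M. absorption_time L X \<omega> > ereal t)" for n
    unfolding survival_def
    by (rule finite_measure_mono) (use absorption_event[OF t] absorption_event_measurable[OF t] in auto)
  moreover have "(\<lambda>n. survival (t + 1 / real (Suc n))) \<longlonglongrightarrow> survival t"
  proof -
    have c: "continuous_on {0..} survival"
      unfolding survival_eq [abs_def] by (intro continuous_intros G_continuous_on) auto
    have "(\<lambda>n. t + 1 / real (Suc n)) \<longlonglongrightarrow> t + 0"
      using LIMSEQ_inverse_real_of_nat by (intro tendsto_add tendsto_const) (simp add: inverse_eq_divide)
    then show ?thesis
      using c t by (intro continuous_on_tendsto_compose[OF c]) auto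
  qed
  ultimately show "survival t \<le> \<P>(\<omega> in M. absorption_time L X \<omega> > ereal t)"
    by (intro LIMSEQ_le_const2) auto
qed

text \<open>For k >= 1 the event Z t = k lies in the event of survival at t, which exceeds T > t by
  a null set only.\<close>

lemma prob_Z_absorption:
  assumes t: "0 \<le> t" and k: "k \<ge> 1"
  shows "\<P>(\<omega> in M. Z L X t \<omega> = Some (enat k) \<bar> absorption_time L X \<omega> > ereal t) =
    \<P>(\<omega> in M. Z L X t \<omega> = Some (enat k)) / survival t"
proof -
  let ?A = "{\<omega>\<in>space M. absorption_time L X \<omega> > ereal t}"
  let ?B = "{\<omega>\<in>space M. Z L X t \<omega> \<notin> {None, Some 0}}"
  let ?C = "{\<omega>\<in>space M. Z L X t \<omega> = Some (enat k)}"
  note [measurable] = absorption_event_measurable[OF t]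
  have "prob (?B - ?A) = prob ?B - prob ?A"
    by (rule finite_measure_Diff) (use absorption_event_subset[OF t] in auto)
  then have 0: "prob (?B - ?A) = 0"
    using prob_absorption[OF t] by (simp add: survival_def)
  have "?C - ?A \<subseteq> ?B - ?A" using k by (auto simp: zero_enat_def)
  then have "prob (?C - ?A) \<le> prob (?B - ?A)" by (intro finite_measure_mono) auto
  then have "prob (?C - ?A) = 0" using 0 measure_nonneg[of M "?C - ?A"] by linarith
  moreover have "prob ?C = prob (?C \<inter> ?A) + prob (?C - ?A)"
    by (subst finite_measure_Union [symmetric]) (auto intro!: arg_cong[where f = prob])
  moreover have "?C \<inter> ?A = {\<omega>\<in>space M. Z L X t \<omega> = Some (enat k) \<and> absorption_time L X \<omega> > ereal t}"
    by auto
  ultimately show ?thesis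
    using prob_absorption[OF t] by (simp add: cond_prob_def)
qed

end

section \<open>Asymptotics\<close>

text \<open>H stays a parameter so that K, the probabilities and the power series of
  \<open>K_primitive\<close> all refer to the same primitive of \<eta>.\<close>

locale extendable_branching =
  branching_process M p L X + extendable_gf p q r
  for M :: "'w measure" and p L X q r +
  fixes H :: "real \<Rightarrow> real"
  assumes H_q: "H q = 0"
    and H_deriv: "\<And>x. x \<in> {0..<r} \<Longrightarrow> (H has_real_derivative \<eta> x) (at x within {0..<r})"
begin

definition K :: "real \<Rightarrow> real" where "K s = (s - q) * exp (H s)"

lemma G_range: "0 \<le> s \<Longrightarrow> s \<le> 1 \<Longrightarrow> G s t \<in> {0..<r}"
  using G_bounds[of s t] r_gt_1 by auto

lemma H_continuous_on: "continuous_on {0..<r} H"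
  unfolding continuous_on_eq_continuous_within using DERIV_continuous[OF H_deriv] by simp

lemma G_flow:
  assumes s: "0 \<le> s" "s \<le> 1" and t: "0 \<le> t"
  shows "(G s t - q) * exp (H (G s t)) = exp (- \<alpha> * t) * K s"
  using flow_invariant[OF H_deriv G_bounds[OF s] G_has_derivative[OF s] t]
  by (simp add: K_def G_0[OF s])

text \<open>On the compact interval [0, 1] the factor exp (H x) is bounded below by a positive
  \<open>m\<close>, so \<open>G_flow\<close> bounds the distance to q by a multiple of exp (-
  \<alpha> t).\<close>

lemma G_tendsto_q:
  assumes s: "0 \<le> s" "s \<le> 1"
  shows "(G s \<longlongrightarrow> q) at_top"
proof -
  have "continuous_on {0..1} (\<lambda>x. exp (H x))"
    by (intro continuous_intros continuous_on_subset[OF H_continuous_on]) (use r_gt_1 in auto)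
  then have "\<exists>x0\<in>{0..1}. \<forall>x\<in>{0..1}. exp (H x0) \<le> exp (H x)"
    by (intro continuous_attains_inf) auto
  then obtain x0 where x0: "\<And>x. x \<in> {0..1} \<Longrightarrow> exp (H x0) \<le> exp (H x)"
    by blast
  define m where "m = exp (H x0)"
  have bd: "norm (G s t - q) \<le> exp (- \<alpha> * t) * (\<bar>K s\<bar> / m)" if "t \<ge> 0" for t
  proof -
    have "\<bar>G s t - q\<bar> * m \<le> \<bar>G s t - q\<bar> * exp (H (G s t))"
      unfolding m_def using x0[OF G_bounds[OF s]] by (intro mult_left_mono) auto
    also have "\<dots> = exp (- \<alpha> * t) * \<bar>K s\<bar>"
      using arg_cong[OF G_flow[OF s that], of abs] by (simp add: abs_mult)
    finally show ?thesis by (simp add: m_def field_simps)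
  qed
  have ev: "eventually (\<lambda>t. norm (G s t - q) \<le> exp (- \<alpha> * t) * (\<bar>K s\<bar> / m)) at_top"
    by (rule eventually_mono[OF eventually_ge_at_top[of 0]]) (rule bd)
  have "((\<lambda>t. exp (- a * t)) \<longlongrightarrow> 0) at_top" if "a > 0" for a :: real
    using that by real_asymp
  from this[OF \<alpha>_pos] have "((\<lambda>t. exp (- \<alpha> * t) * (\<bar>K s\<bar> / m)) \<longlongrightarrow> 0) at_top"
    by (rule tendsto_mult_left_zero)
  then have "((\<lambda>t. G s t - q) \<longlongrightarrow> 0) at_top"
    by (rule Lim_null_comparison[OF ev])
  then show ?thesis by (simp add: LIM_zero_iff)
qed

text \<open>The limit of D has to be its value at q, because G s t may equal q, as it does for s =
  q.\<close>

lemma tendsto_compose_G: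
  assumes "(D \<longlongrightarrow> D q) (at q within {0..<r})" "0 \<le> s" "s \<le> 1"
  shows "((\<lambda>t. D (G s t)) \<longlongrightarrow> D q) at_top"
  using continuous_within_tendsto_compose[of q "{0..<r}" D "G s" at_top] assms G_tendsto_q G_range
  by (simp add: continuous_within)

lemma G_first_order:
  assumes s: "0 \<le> s" "s \<le> 1"
  shows "((\<lambda>t. exp (\<alpha> * t) * (G s t - q)) \<longlongrightarrow> K s) at_top"
proof -
  have "(H \<longlongrightarrow> H q) (at q within {0..<r})"
    using H_continuous_on q_bounds by (auto simp: continuous_on_def)
  then have "((\<lambda>t. K s * exp (- H (G s t))) \<longlongrightarrow> K s * exp (- H q)) at_top"
    by (intro tendsto_intros tendsto_compose_G s)
  then have "((\<lambda>t. K s * exp (- H (G s t))) \<longlongrightarrow> K s) at_top" by (simp add: H_q)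
  then show ?thesis
  proof (rule Lim_transform_eventually)
    show "eventually (\<lambda>t. K s * exp (- H (G s t)) = exp (\<alpha> * t) * (G s t - q)) at_top"
      using eventually_ge_at_top[of 0]
    proof eventually_elim
      case (elim t)
      then show ?case using G_flow[OF s elim] by (simp add: exp_minus field_simps)
    qed
  qed
qed

lemma G_second_order:
  assumes s: "0 \<le> s" "s \<le> 1"
  shows "((\<lambda>t. exp (2 * \<alpha> * t) * (G s t - q - exp (- \<alpha> * t) * K s)) \<longlongrightarrow> - (\<eta> q * (K s)\<^sup>2)) at_top"
proof -
  \<comment> \<open>The difference quotient of x \<mapsto> exp (H x) at q, extended by its limit
    \<eta> q, since H q = 0. With it the remainder is exactly - (G - q)^2 D(G), which is where the
    minus sign comes from.\<close>
  define D where "D x = (if x = q then \<eta> q else (exp (H x) - 1) / (x - q))" for x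
  have D: "exp (H x) - 1 = (x - q) * D x" for x by (simp add: D_def H_q)
  have "((\<lambda>x. exp (H x)) has_real_derivative exp (H q) * \<eta> q) (at q within {0..<r})"
    using q_bounds by (auto intro!: derivative_eq_intros H_deriv)
  then have "((\<lambda>x. (exp (H x) - 1) / (x - q)) \<longlongrightarrow> D q) (at q within {0..<r})"
    by (simp add: has_field_derivative_iff H_q D_def)
  then have "(D \<longlongrightarrow> D q) (at q within {0..<r})"
    by (rule Lim_transform_eventually) (auto simp: D_def eventually_at_filter)
  then have "((\<lambda>t. - ((exp (\<alpha> * t) * (G s t - q))\<^sup>2 * D (G s t))) \<longlongrightarrow> - ((K s)\<^sup>2 * D q)) at_top"
    by (intro tendsto_intros G_first_order tendsto_compose_G s)
  then have "((\<lambda>t. - ((exp (\<alpha> * t) * (G s t - q))\<^sup>2 * D (G s t))) \<longlongrightarrow> - (\<eta> q * (K s)\<^sup>2)) at_top"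
    by (simp add: D_def mult.commute)
  then show ?thesis
  proof (rule Lim_transform_eventually)
    show "eventually (\<lambda>t. - ((exp (\<alpha> * t) * (G s t - q))\<^sup>2 * D (G s t)) =
        exp (2 * \<alpha> * t) * (G s t - q - exp (- \<alpha> * t) * K s)) at_top"
      using eventually_ge_at_top[of 0]
    proof eventually_elim
      case (elim t)
      have "G s t - q - exp (- \<alpha> * t) * K s = - ((G s t - q) * (exp (H (G s t)) - 1))"
        using G_flow[OF s elim] by (simp add: algebra_simps)
      also have "\<dots> = - ((G s t - q)\<^sup>2 * D (G s t))"
        unfolding D by (simp add: power2_eq_square)
      finally show ?case
        by (simp add: power_mult_distrib mult.assoc flip: exp_double)
    qed
  qed
qed

lemma survival_expansion:
  "(\<lambda>t. survival t - ((K 1 - K 0) * exp (-\<alpha> * t) - \<eta> q * ((K 1)\<^sup>2 - (K 0)\<^sup>2) * exp (-2 * \<alpha> * t)))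
    \<in> o[at_top](\<lambda>t. exp (-2 * \<alpha> * t))"
proof (rule smalloI_tendsto)
  let ?E = "\<lambda>s t. exp (2 * \<alpha> * t) * (G s t - q - exp (- \<alpha> * t) * K s)"
  have "((\<lambda>t. ?E 1 t - ?E 0 t + \<eta> q * ((K 1)\<^sup>2 - (K 0)\<^sup>2)) \<longlongrightarrow>
      - (\<eta> q * (K 1)\<^sup>2) - - (\<eta> q * (K 0)\<^sup>2) + \<eta> q * ((K 1)\<^sup>2 - (K 0)\<^sup>2)) at_top"
    by (intro tendsto_intros G_second_order) auto
  then have "((\<lambda>t. ?E 1 t - ?E 0 t + \<eta> q * ((K 1)\<^sup>2 - (K 0)\<^sup>2)) \<longlongrightarrow> 0) at_top"
    by (simp add: algebra_simps)
  moreover have "?E 1 t - ?E 0 t + \<eta> q * ((K 1)\<^sup>2 - (K 0)\<^sup>2) =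
     (survival t - ((K 1 - K 0) * exp (-\<alpha> * t) - \<eta> q * ((K 1)\<^sup>2 - (K 0)\<^sup>2) * exp (-2 * \<alpha> * t))) / exp (-2 * \<alpha> * t)" for t
    by (simp add: survival_eq exp_minus field_simps)
  ultimately show "((\<lambda>t. (survival t - ((K 1 - K 0) * exp (-\<alpha> * t) - \<eta> q * ((K 1)\<^sup>2 - (K 0)\<^sup>2) * exp (-2 * \<alpha> * t)))
      / exp (-2 * \<alpha> * t)) \<longlongrightarrow> 0) at_top" by simp
qed auto

text \<open>By \<open>\<eta>_key\<close>, K' = \<alpha> exp (H x) / ((r - x) C(x)) > 0 with C =
  \<open>gf f_qr\<close>. The limit law divides by K 1 - K 0.\<close>

lemma K_0_less_1: "K 0 < K 1"
proof (rule DERIV_pos_imp_increasing_open[where f = K])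
  fix x :: real assume x: "0 < x" "x < 1"
  then have x': "0 \<le> x" "x < r" "x \<in> {0<..<r}" using r_gt_1 by auto
  have "at x within {0..<r} = at x"
    using x' by (intro at_within_interior) (auto simp: interior_atLeastLessThan)
  then have "(H has_real_derivative \<eta> x) (at x)" using H_deriv[of x] x' by auto
  then have "(K has_real_derivative exp (H x) * (1 + (x - q) * \<eta> x)) (at x)"
    unfolding K_def [abs_def] by (auto intro!: derivative_eq_intros simp: algebra_simps)
  moreover have "1 + (x - q) * \<eta> x > 0"
  proof -
    have "(1 + (x - q) * \<eta> x) * ((r - x) * gf f_qr x) > 0" "(r - x) * gf f_qr x > 0"
      using \<eta>_key[OF x'(1,2)] \<alpha>_pos gf_f_qr_pos[of x] x' by auto
    then show ?thesis by (simp add: zero_less_mult_iff)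
  qed
  ultimately show "\<exists>y. (K has_real_derivative y) (at x) \<and> y > 0" by auto
next
  show "continuous_on {0..1} K"
    unfolding K_def [abs_def]
    by (intro continuous_intros continuous_on_subset[OF H_continuous_on]) (use r_gt_1 in auto)
qed simp

lemma survival_first_order: "((\<lambda>t. exp (\<alpha> * t) * survival t) \<longlongrightarrow> K 1 - K 0) at_top"
proof -
  have "((\<lambda>t. exp (\<alpha> * t) * (G 1 t - q) - exp (\<alpha> * t) * (G 0 t - q)) \<longlongrightarrow> K 1 - K 0) at_top"
    by (intro tendsto_intros G_first_order) auto
  then show ?thesis by (simp add: survival_eq algebra_simps)
qed

text \<open>The rescaled probabilities are bounded by the rescaled survival probability, which
  converges; this is the bound needed to pass from generating functions to coefficients.\<close>

lemma prob_Z_first_order: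
  assumes c: "\<And>x. x \<in> {0..<r} \<Longrightarrow> (\<lambda>k. c k * x ^ k) sums K x" and k: "k \<ge> 1"
  shows "((\<lambda>t. exp (\<alpha> * t) * \<P>(\<omega> in M. Z L X t \<omega> = Some (enat k))) \<longlongrightarrow> c k) at_top"
proof -
  define P where "P t k = \<P>(\<omega> in M. Z L X t \<omega> = Some (enat k))" for t k
  \<comment> \<open>The coefficient at 0 is dropped on both sides: P(Z = 0) tends to q, so for q > 0
    it is not of order exp (- \<alpha> t).\<close>
  define a where "a t k = (if k = 0 then 0 else exp (\<alpha> * t) * P t k)" for t k
  define c' where "c' k = (if k = 0 then 0 else c k)" for k
  have P0: "P t 0 = G 0 t" for t by (simp add: P_def G_0_eq zero_enat_def)
  have c0: "c 0 = K 0"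
    using c[of 0] q_bounds powser_sums_zero sums_unique2 by fastforce
  have drop: "(\<lambda>k. (if k = 0 then 0 else v k) * s ^ k) sums (V - v 0)"
    if "(\<lambda>k. v k * s ^ k) sums V" for v :: "nat \<Rightarrow> real" and s V
  proof -
    have "(\<lambda>k. v (Suc k) * s ^ Suc k) sums (V - v 0 * s ^ 0)"
      using that by (subst sums_Suc_iff) simp
    then have "(\<lambda>k. (if Suc k = 0 then 0 else v (Suc k)) * s ^ Suc k) sums (V - v 0)" by simp
    then show ?thesis by (subst (asm) sums_Suc_iff) simp
  qed
  have "((\<lambda>t. a t k) \<longlongrightarrow> c' k) at_top"
  proof (rule power_series_coeff_tendsto[where B = "K 1 - K 0 + 1"])
    show "a t k \<ge> 0" for t k by (auto simp: a_def P_def)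
    have "eventually (\<lambda>t. exp (\<alpha> * t) * survival t < K 1 - K 0 + 1) at_top"
      by (rule order_tendstoD[OF survival_first_order]) simp
    then show "eventually (\<lambda>t. \<forall>k. a t k \<le> K 1 - K 0 + 1) at_top"
    proof eventually_elim
      case (elim t)
      have "a t k \<le> exp (\<alpha> * t) * survival t" for k
      proof (cases "k = 0")
        case False
        then have "P t k \<le> survival t"
          unfolding P_def survival_def by (intro finite_measure_mono) (auto simp: zero_enat_def)
        then show ?thesis using False by (simp add: a_def)
      qed (simp add: a_def survival_def)
      with elim show ?case by (meson le_less_trans less_imp_le)
    qed
    fix s :: real assume s: "0 < s" "s < 1"
    show "(\<lambda>k. a t k * s ^ k) sums (exp (\<alpha> * t) * (G s t - G 0 t))" for t
    proof -
      have "(\<lambda>k. P t k * s ^ k) sums G s t"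
        unfolding P_def by (rule G_sums) (use s in auto)
      from sums_mult[OF drop[OF this], of "exp (\<alpha> * t)"] show ?thesis
        unfolding P0 by (rule sums_cong[THEN iffD1, rotated]) (simp add: a_def)
    qed
    show "(\<lambda>k. c' k * s ^ k) sums (K s - K 0)"
      using drop[OF c[of s]] s r_gt_1 by (simp add: c'_def c0)
    have "((\<lambda>t. exp (\<alpha> * t) * (G s t - q) - exp (\<alpha> * t) * (G 0 t - q)) \<longlongrightarrow> K s - K 0) at_top"
      by (intro tendsto_intros G_first_order) (use s in auto)
    then show "((\<lambda>t. exp (\<alpha> * t) * (G s t - G 0 t)) \<longlongrightarrow> K s - K 0) at_top"
      by (simp add: algebra_simps)
  qed
  then show ?thesis using k by (simp add: a_def c'_def P_def)
qed

lemma cond_prob_Z_tendsto: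
  assumes c: "\<And>x. x \<in> {0..<r} \<Longrightarrow> (\<lambda>k. c k * x ^ k) sums K x" and k: "k \<ge> 1"
  shows "((\<lambda>t. \<P>(\<omega> in M. Z L X t \<omega> = Some (enat k) \<bar> absorption_time L X \<omega> > ereal t))
    \<longlongrightarrow> c k / (K 1 - K 0)) at_top"
proof -
  have "((\<lambda>t. exp (\<alpha> * t) * \<P>(\<omega> in M. Z L X t \<omega> = Some (enat k)) / (exp (\<alpha> * t) * survival t))
      \<longlongrightarrow> c k / (K 1 - K 0)) at_top"
    by (intro tendsto_divide prob_Z_first_order[OF c k] survival_first_order) (use K_0_less_1 in auto)
  then show ?thesis
    by (rule Lim_transform_eventually)
       (rule eventually_mono[OF eventually_ge_at_top[of 0]], simp add: prob_Z_absorption[OF _ k])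
qed

end

theorem theorem17:
  fixes M :: "'w measure"
    and p :: "nat \<Rightarrow> real"
    and L :: "nat list \<Rightarrow> 'w \<Rightarrow> real"
    and X :: "nat list \<Rightarrow> 'w \<Rightarrow> nat option"
    and q r \<alpha> \<beta> \<gamma> :: real
    and \<psi> K :: "real \<Rightarrow> real"
    and T :: "'w \<Rightarrow> ereal"
  assumes "branching_process M p L X"
    and "extendable p q r"
    and "r > 1"
    and "summable (\<lambda>k. diffs p k * r ^ k)"
    and "T = absorption_time L X"
    and "\<alpha> = 1 - gf (diffs p) q"
    and "\<beta> = gf (diffs p) r - 1"
    and "\<gamma> = \<alpha> / \<beta>"
    and "\<And>x. x \<in> {0..<r} \<Longrightarrow>
           \<psi> x = (tail_gf p [q, q, r, x] - \<gamma> * tail_gf p [q, r, r, x]) / tail_gf p [q, r, x]"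
    and "\<And>s. s \<in> {0..<r} \<Longrightarrow>
           K s = (s - q) * (r - q) powr \<gamma> * (r - s) powr (-\<gamma>) * exp (LBINT x=s..q. \<psi> x)"
  shows "((\<lambda>t. \<P>(\<omega> in M. T \<omega> > ereal t)
            - ((K 1 - K 0) * exp (-\<alpha> * t)
               - gf (diffs (diffs p)) q / (2 * \<alpha>) * ((K 1)\<^sup>2 - (K 0)\<^sup>2) * exp (-2 * \<alpha> * t)))
          \<in> o[at_top](\<lambda>t. exp (-2 * \<alpha> * t))) \<and>
         (\<exists>\<pi> :: nat \<Rightarrow> real.
           (\<forall>k\<ge>1. ((\<lambda>t. \<P>(\<omega> in M. Z L X t \<omega> = Some (enat k) \<bar> T \<omega> > ereal t)) \<longlongrightarrow> \<pi> k) at_top) \<and>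
           (\<forall>s\<in>{0..<r}. (\<lambda>k. \<pi> (Suc k) * s ^ Suc k) sums ((K s - K 0) / (K 1 - K 0))) \<and>
           (modified_linear_fractional p \<longrightarrow>
              (\<forall>s\<in>{0..<r}. K s = (s - q) * (r - q) powr \<gamma> * (r - s) powr (-\<gamma>)) \<and>
              (\<exists>c>0. \<pi> \<sim>[at_top] (\<lambda>k. c * real k powr (\<gamma> - 1) * r powr (- real k)))))"
proof -
  interpret BP: branching_process M p L X by fact
  interpret E: extendable_gf p q r
    by unfold_locales (use BP.p_nonneg BP.p_1 assms in auto)
  obtain H c where H: "H q = 0"
    "\<And>x. x \<in> {0..<r} \<Longrightarrow> (H has_real_derivative E.\<eta> x) (at x within {0..<r})"
    and c: "\<And>x. x \<in> {0..<r} \<Longrightarrow> (\<lambda>k. c k * x ^ k) sums ((x - q) * exp (H x))"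
    using E.K_primitive by blast
  interpret EB: extendable_branching M p L X q r H
    by unfold_locales (use H in auto)
  have \<alpha>: "\<alpha> = E.\<alpha>" and \<beta>: "\<beta> = E.\<beta>" and \<gamma>: "\<gamma> = E.\<gamma>"
    using assms by (simp_all add: E.\<alpha>_def E.\<beta>_def E.\<gamma>_def)
  have \<psi>: "\<psi> x = E.\<psi>r x" if "x \<in> {0..<r}" for x
    using assms(9)[OF that] E.\<psi>r_eq[of x] that by (simp add: \<gamma>)
  have K: "K s = EB.K s" if "s \<in> {0..<r}" for s
    using assms(10)[OF that] E.K_eq_exp[OF H \<psi> that] by (simp add: \<gamma> EB.K_def)
  have K01: "K 0 = EB.K 0" "K 1 = EB.K 1" using K assms(3) by auto
  \<comment> \<open>The coefficients of K are \<open>c\<close>. The value \<pi> 0 = K 0 / (K 1 - K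
    0) is left over from the constant term and lies outside the limit law, whose indices start at
    1.\<close>
  define \<pi> where "\<pi> k = c k / (K 1 - K 0)" for k
  have c': "(\<lambda>k. c k * x ^ k) sums EB.K x" if "x \<in> {0..<r}" for x
    using c[OF that] by (simp add: EB.K_def)
  have pos: "K 1 - K 0 > 0" using EB.K_0_less_1 by (simp add: K01)
  have "((\<lambda>t. \<P>(\<omega> in M. T \<omega> > ereal t)
            - ((K 1 - K 0) * exp (-\<alpha> * t)
               - gf (diffs (diffs p)) q / (2 * \<alpha>) * ((K 1)\<^sup>2 - (K 0)\<^sup>2) * exp (-2 * \<alpha> * t)))
          \<in> o[at_top](\<lambda>t. exp (-2 * \<alpha> * t)))"
  \<comment> \<open>T > t is identified with survival for t >= 0 only, hence the passage through
    eventual equality.\<close>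
  proof (rule landau_o.small.in_cong[THEN iffD2])
    show "(\<lambda>t. BP.survival t - ((K 1 - K 0) * exp (-\<alpha> * t)
         - gf (diffs (diffs p)) q / (2 * \<alpha>) * ((K 1)\<^sup>2 - (K 0)\<^sup>2) * exp (-2 * \<alpha> * t)))
          \<in> o[at_top](\<lambda>t. exp (-2 * \<alpha> * t))"
      using EB.survival_expansion by (simp add: K01 \<alpha> E.\<eta>_q)
    show "eventually (\<lambda>t. \<P>(\<omega> in M. T \<omega> > ereal t)
            - ((K 1 - K 0) * exp (-\<alpha> * t)
               - gf (diffs (diffs p)) q / (2 * \<alpha>) * ((K 1)\<^sup>2 - (K 0)\<^sup>2) * exp (-2 * \<alpha> * t)) =
        BP.survival t - ((K 1 - K 0) * exp (-\<alpha> * t)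
         - gf (diffs (diffs p)) q / (2 * \<alpha>) * ((K 1)\<^sup>2 - (K 0)\<^sup>2) * exp (-2 * \<alpha> * t))) at_top"
      by (rule eventually_mono[OF eventually_ge_at_top[of 0]]) (simp add: assms(5) BP.prob_absorption)
  qed
  moreover have "((\<lambda>t. \<P>(\<omega> in M. Z L X t \<omega> = Some (enat k) \<bar> T \<omega> > ereal t)) \<longlongrightarrow> \<pi> k) at_top"
    if "k \<ge> 1" for k
    using EB.cond_prob_Z_tendsto[OF c' that] by (simp add: assms(5) \<pi>_def K01)
  moreover have "(\<lambda>k. \<pi> (Suc k) * s ^ Suc k) sums ((K s - K 0) / (K 1 - K 0))" if s: "s \<in> {0..<r}" for s
  proof -
    have "c 0 = K 0"
      using sums_unique2[OF c'[of 0] powser_sums_zero] s by (simp add: K01)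
    then have "(\<lambda>k. c (Suc k) * s ^ Suc k) sums (K s - K 0)"
      using c'[OF s] K[OF s] by (subst sums_Suc_iff) simp
    from sums_divide[OF this, of "K 1 - K 0"] show ?thesis by (simp add: \<pi>_def)
  qed
  moreover have KL: "K s = (s - q) * (r - q) powr \<gamma> * (r - s) powr (-\<gamma>)"
    if "modified_linear_fractional p" "s \<in> {0..<r}" for s
  proof -
    have "(LBINT x=s..q. \<psi> x) = (LBINT x=s..q. 0)"
    proof (rule interval_integral_cong)
      fix x assume "x \<in> einterval (min (ereal s) (ereal q)) (max (ereal s) (ereal q))"
      then have "x \<in> {0..<r}"
        using that(2) E.q_bounds by (auto simp: einterval_iff min_def max_def split: if_splits)
      then show "\<psi> x = 0" using \<psi> E.\<psi>r_modified_linear_fractional[OF that(1)] by simp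
    qed
    then show ?thesis using assms(10)[OF that(2)] by simp
  qed
  moreover have "\<exists>c>0. \<pi> \<sim>[at_top] (\<lambda>k. c * real k powr (\<gamma> - 1) * r powr (- real k))"
    if "modified_linear_fractional p"
  proof -
    let ?C = "(r - q) powr \<gamma> * r powr (-\<gamma>) * (r - q) * rGamma \<gamma>"
    have "(\<lambda>k. c k * s ^ k) sums ((s - q) * (r - q) powr \<gamma> * (r - s) powr (-\<gamma>))" if "s \<in> {0..<r}" for s
      using c'[OF that] K[OF that] KL[OF \<open>modified_linear_fractional p\<close> that] by simp
    then have "c \<sim>[at_top] (\<lambda>k. ?C * real k powr (\<gamma> - 1) * r powr (- real k))"
      using E.linear_fractional_coeffs_asymp[of c] by (simp add: \<gamma>)
    then have "(\<lambda>k. c k / (K 1 - K 0)) \<sim>[at_top] (\<lambda>k. ?C * real k powr (\<gamma> - 1) * r powr (- real k) / (K 1 - K 0))"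
      by (intro asymp_equiv_intros)
    then have "\<pi> \<sim>[at_top] (\<lambda>k. ?C / (K 1 - K 0) * real k powr (\<gamma> - 1) * r powr (- real k))"
      by (simp add: \<pi>_def [abs_def])
    moreover have "?C / (K 1 - K 0) > 0"
      using pos E.q_bounds E.\<gamma>_pos Gamma_real_pos[of \<gamma>] by (simp add: \<gamma> rGamma_inverse_Gamma)
    ultimately show ?thesis by blast
  qed
  ultimately show ?thesis by blast
qed

end
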